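(* Let $\theta\in[0,1]$, let $f\in L^2([0,T];[L^2(D)]^2)$ and $u_0^h,u_1^h\in X_h$, and assume that the time steps satisfy $$C_\beta^{(n)}\,|\rho|\,\widehat k_n\le \frac{1+\theta}{4},\qquad n=1,\dots,M-1,\qquad\text{where } C_\beta^{(n)}=\sum_{\ell=0}^2\big(\beta_\ell^{(n)}\big)^2 .$$ Then every solution $(u_n^h,w_n^h,p_n^h)$ of the fully discrete DLN scheme (described in the context) is bounded in kinetic energy: there are constants $C>0$ and $C(\theta)>0$ such that for all $1<m\le M$, $$\frac{1+\theta}{4}\|u_m^h\|^2+\sum_{n=1}^{m-1}\Big[\Big\|\sum_{\ell=0}^2 a_\ell^{(n)}u_{n-1+\ell}^h\Big\|^2+\widehat k_n\Big(\frac{\mu}{2}\|\nabla u_{n,\beta}^h\|^2+\gamma\|w_{n,\beta}^h\|^2+\lambda\|u_{n,\beta}^h\|_{L^4}^4\Big)\Big]$$ $$\le \exp\big(C(\theta)T\big)\Big(\frac{1+\theta}{4}\|u_1^h\|^2+\frac{1+\theta}{4}\|u_0^h\|^2+\frac{C}{\mu}\sum_{n=1}^{m-1}\widehat k_n\|f_{n,\beta}\|^2\Big).$$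
   Context: $D\subset\mathbb R^2$ is a bounded domain with Lipschitz boundary, $T>0$; $\mu>0$, $\gamma\ge0$, $\nu\ge 0$, $\lambda\ge0$, $\rho\in\mathbb R$ are fixed parameters. $\|\cdot\|$ and $(\cdot,\cdot)$ are the $L^2(D)$ norm and inner product. $X=\{v\in[H^1(D)]^2: v=0\text{ on }\partial D\}$, $Q=\{q\in L^2(D):\int_D q\,dx=0\}$, and for $u,v,w\in X$, $b(u,v,w)=\tfrac12(u\cdot\nabla v,w)-\tfrac12(u\cdot\nabla w,v)$. Time grid and DLN notation: $0=t_0<t_1<\dots<t_M=T$ is an arbitrary partition, $k_n=t_{n+1}-t_n$, $\varepsilon_n=(k_n-k_{n-1})/(k_n+k_{n-1})\in(-1,1)$. For $\theta\in[0,1]$: $\alpha_2=\tfrac12(\theta+1)$, $\alpha_1=-\theta$, $\alpha_0=\tfrac12(\theta-1)$, and $\beta_2^{(n)}=\tfrac14\big(1+\tfrac{1-\theta^2}{(1+\varepsilon_n\theta)^2}+\varepsilon_n^2\tfrac{\theta(1-\theta^2)}{(1+\varepsilon_n\theta)^2}+\theta\big)$, $\beta_1^{(n)}=\tfrac12\big(1-\tfrac{1-\theta^2}{(1+\varepsilon_n\theta)^2}\big)$, $\beta_0^{(n)}=\tfrac14\big(1+\tfrac{1-\theta^2}{(1+\varepsilon_n\theta)^2}-\varepsilon_n^2\tfrac{\theta(1-\theta^2)}{(1+\varepsilon_n\theta)^2}-\theta\big)$. The weighted average step is $\widehat k_n=\alpha_2k_n-\alpha_0k_{n-1}$. For a sequence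 $z_n$: $z_{n,\alpha}=\alpha_2z_{n+1}+\alpha_1z_n+\alpha_0z_{n-1}$, $z_{n,\beta}=\beta_2^{(n)}z_{n+1}+\beta_1^{(n)}z_n+\beta_0^{(n)}z_{n-1}$; $f_n=f(t_n)$ (assumed to be well-defined elements of $[L^2(D)]^2$). Also $a_1^{(n)}=-\frac{\sqrt{\theta(1-\theta^2)}}{\sqrt2(1+\varepsilon_n\theta)}$, $a_2^{(n)}=-\frac{1-\varepsilon_n}{2}a_1^{(n)}$, $a_0^{(n)}=-\frac{1+\varepsilon_n}{2}a_1^{(n)}$. Finite elements: $\mathscr T_h$ ($0<h<1$) is a regular partition of $\overline D$ with mesh size $h$, $r\ge1$ an integer (the paper uses Taylor–Hood, $r=1$), $X_h=\{v^h\in[C^0(\overline D)]^2\cap X: v^h|_K\in[P_{r+1}(K)]^2\ \forall K\in\mathscr T_h\}$, $Q_h=\{q^h\in C^0(\overline D)\cap Q:q^h|_K\in P_r(K)\ \forall K\in\mathscr T_h\}$, $V_h=\{v^h\in X_h:(\nabla\cdot v^h,q^h)=0\ \forall q^h\in Q_h\}$. The pair $(X_h,Q_h)$ satisfies the discrete inf-sup condition $\|q^h\|\le C\sup_{0\ne v^h\in X_h}(\nabla\cdot v^h,q^h)/\|\nabla v^h\|$ for all $q^h\in Q_h$. Fully discrete DLN scheme: given $u_n^h,u_{n-1}^h\in X_h$, $w_n^h,w_{n-1}^h\in V_h$, $p_n^h,p_{n-1}^h\in Q_h$, find $(u_{n+1}^h,w_{n+1}^h,p_{n+1}^h)\in X_h\times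 V_h\times Q_h$ such that for all $(v^h,\varphi^h,q^h)\in X_h\times V_h\times Q_h$ and $n=1,\dots,M-1$: (i) $\frac1{\widehat k_n}(u_{n,\alpha}^h,v^h)+\mu(\nabla u_{n,\beta}^h,\nabla v^h)+\gamma(\nabla w_{n,\beta}^h,\nabla v^h)+\nu b(u_{n,\beta}^h,u_{n,\beta}^h,v^h)+\rho(u_{n,\beta}^h,v^h)+\lambda(|u_{n,\beta}^h|^2u_{n,\beta}^h,v^h)-(p_{n,\beta}^h,\nabla\cdot v^h)=(f_{n,\beta},v^h)$; (ii) $(w_{n+1}^h,\varphi^h)=(\nabla u_{n+1}^h,\nabla\varphi^h)$; (iii) $(\nabla\cdot u_{n+1}^h,q^h)=0$. The starting values also satisfy relations (ii) and (iii) at time levels $0$ and $1$. The constants $C$ and $C(\theta)$ do not depend on $h$, the time steps, $m$, $f$ or the discrete solution; $C(\theta)$ may depend on $\theta$ and on the fixed model parameters. *)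

theory Defs
  imports "HOL-Analysis.Analysis"
begin

section \<open>Domains\<close>

text \<open>Near each boundary point, \<open>D\<close> is, in suitable orthonormal coordinates \<open>(e1, e2)\<close>
  centred at that point, the part of the plane strictly above the graph of a Lipschitz function.\<close>

definition lipschitz_boundary :: "(real^2) set \<Rightarrow> bool" where
  "lipschitz_boundary D \<longleftrightarrow>
     (\<forall>p\<in>frontier D. \<exists>r>0. \<exists>e1 e2 :: real^2. \<exists>(L::real) (g :: real \<Rightarrow> real).
        norm e1 = 1 \<and> norm e2 = 1 \<and> e1 \<bullet> e2 = 0 \<and> L-lipschitz_on UNIV g \<and>
        D \<inter> ball p r = {x \<in> ball p r. g ((x - p) \<bullet> e1) < (x - p) \<bullet> e2})"

definition bounded_lipschitz_domain :: "(real^2) set \<Rightarrow> bool" where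
  "bounded_lipschitz_domain D \<longleftrightarrow>
     open D \<and> connected D \<and> D \<noteq> {} \<and> bounded D \<and> lipschitz_boundary D"


section \<open>Lebesgue and Sobolev spaces\<close>

text \<open>Functions on \<open>D\<close> are total functions on the plane; only their values on \<open>D\<close> (on the closure
  of \<open>D\<close> for continuous functions) matter.  Functions are not identified up to null sets.\<close>

definition L2_space :: "(real^2) set \<Rightarrow> (real^2 \<Rightarrow> 'b::euclidean_space) set" where
  "L2_space D = {v. v \<in> borel_measurable (lebesgue_on D) \<and>
                    integrable (lebesgue_on D) (\<lambda>x. (norm (v x))\<^sup>2)}"

definition l2_inner :: "(real^2) set \<Rightarrow> (real^2 \<Rightarrow> 'b::euclidean_space) \<Rightarrow> (real^2 \<Rightarrow> 'b) \<Rightarrow> real" where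
  "l2_inner D v w = (\<integral>x. v x \<bullet> w x \<partial>lebesgue_on D)"

definition l2_norm :: "(real^2) set \<Rightarrow> (real^2 \<Rightarrow> 'b::euclidean_space) \<Rightarrow> real" where
  "l2_norm D v = sqrt (l2_inner D v v)"

definition l4_norm :: "(real^2) set \<Rightarrow> (real^2 \<Rightarrow> 'b::euclidean_space) \<Rightarrow> real" where
  "l4_norm D v = root 4 (\<integral>x. (norm (v x)) ^ 4 \<partial>lebesgue_on D)"

text \<open>Test functions: the space \<open>C\<^sub>0\<^sup>1(D)\<close> of continuously differentiable functions with compact
  support in \<open>D\<close>.  As in Gilbarg and Trudinger, first-order weak derivatives are tested against
  \<open>C\<^sub>0\<^sup>1(D)\<close>, and \<open>H\<^sup>1\<^sub>0(D)\<close> is its closure; by mollification this gives the same notions as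
  smooth test functions.\<close>

definition C1_compact :: "(real^2) set \<Rightarrow> (real^2 \<Rightarrow> real) set" where
  "C1_compact D = {\<phi>. (\<exists>g. continuous_on UNIV g \<and>
                          (\<forall>x. (\<phi> has_derivative (\<lambda>y. g x \<bullet> y)) (at x))) \<and>
                      compact (closure {x. \<phi> x \<noteq> 0}) \<and> closure {x. \<phi> x \<noteq> 0} \<subseteq> D}"

text \<open>\<open>G\<close> is a weak Jacobian of \<open>v\<close>: entry \<open>G x $ i $ j\<close> is the weak derivative of the \<open>i\<close>-th
  component of \<open>v\<close> in direction \<open>j\<close>.  On matrices (type \<open>real^2^2\<close>), the library's inner product
  and norm are the Frobenius ones.\<close>

definition has_weak_grad :: "(real^2) set \<Rightarrow> (real^2 \<Rightarrow> real^2) \<Rightarrow> (real^2 \<Rightarrow> real^2^2) \<Rightarrow> bool" where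
  "has_weak_grad D v G \<longleftrightarrow>
     (\<forall>\<phi>\<in>C1_compact D. \<forall>i j.
        (\<integral>x. v x $ i * frechet_derivative \<phi> (at x) (axis j 1) \<partial>lebesgue_on D)
        = - (\<integral>x. G x $ i $ j * \<phi> x \<partial>lebesgue_on D))"

definition H1_space :: "(real^2) set \<Rightarrow> (real^2 \<Rightarrow> real^2) set" where
  "H1_space D = {v \<in> L2_space D. \<exists>G\<in>L2_space D. has_weak_grad D v G}"

text \<open>The weak gradient is determined only up to null sets; one representative is selected.\<close>

definition wgrad :: "(real^2) set \<Rightarrow> (real^2 \<Rightarrow> real^2) \<Rightarrow> real^2 \<Rightarrow> real^2^2" where
  "wgrad D v = (SOME G. G \<in> L2_space D \<and> has_weak_grad D v G)"

definition wdiv :: "(real^2) set \<Rightarrow> (real^2 \<Rightarrow> real^2) \<Rightarrow> real^2 \<Rightarrow> real" where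
  "wdiv D v x = (\<Sum>i\<in>UNIV. wgrad D v x $ i $ i)"

definition h1_norm :: "(real^2) set \<Rightarrow> (real^2 \<Rightarrow> real^2) \<Rightarrow> real" where
  "h1_norm D v = sqrt ((l2_norm D v)\<^sup>2 + (l2_norm D (wgrad D v))\<^sup>2)"

text \<open>The condition \<open>v = 0\<close> on the boundary is understood in the usual \<open>H\<^sup>1\<^sub>0\<close> sense.\<close>

definition X_space :: "(real^2) set \<Rightarrow> (real^2 \<Rightarrow> real^2) set" where
  "X_space D = {v \<in> H1_space D.
     \<exists>\<phi> :: nat \<Rightarrow> real^2 \<Rightarrow> real^2. (\<forall>k i. (\<lambda>x. \<phi> k x $ i) \<in> C1_compact D) \<and>
        (\<lambda>k. h1_norm D (\<lambda>x. \<phi> k x - v x)) \<longlonglongrightarrow> 0}"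

definition Q_space :: "(real^2) set \<Rightarrow> (real^2 \<Rightarrow> real) set" where
  "Q_space D = {q \<in> L2_space D. (\<integral>x. q x \<partial>lebesgue_on D) = 0}"

text \<open>The matrix-vector product \<open>wgrad D v x *v u x\<close> is the value of \<open>u \<cdot> \<nabla>v\<close> at \<open>x\<close>.\<close>

definition trilin_b ::
  "(real^2) set \<Rightarrow> (real^2 \<Rightarrow> real^2) \<Rightarrow> (real^2 \<Rightarrow> real^2) \<Rightarrow> (real^2 \<Rightarrow> real^2) \<Rightarrow> real" where
  "trilin_b D u v w = 1/2 * l2_inner D (\<lambda>x. wgrad D v x *v u x) w
                    - 1/2 * l2_inner D (\<lambda>x. wgrad D w x *v u x) v"

text \<open>The Bochner space \<open>L\<^sup>2([0,T]; L\<^sup>2(D))\<close>: almost everywhere limits in \<open>L\<^sup>2(D)\<close> of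
  \<open>L\<^sup>2(D)\<close>-valued simple functions, with square integrable norm.\<close>

definition bochner_L2 :: "real \<Rightarrow> (real^2) set \<Rightarrow> (real \<Rightarrow> real^2 \<Rightarrow> 'b::euclidean_space) \<Rightarrow> bool" where
  "bochner_L2 T D f \<longleftrightarrow>
     (AE t in lebesgue_on {0..T}. f t \<in> L2_space D) \<and>
     (\<exists>(N :: nat \<Rightarrow> nat) (A :: nat \<Rightarrow> nat \<Rightarrow> real set) (g :: nat \<Rightarrow> nat \<Rightarrow> real^2 \<Rightarrow> 'b).
        (\<forall>k i. A k i \<in> sets (lebesgue_on {0..T}) \<and> g k i \<in> L2_space D) \<and>
        (AE t in lebesgue_on {0..T}.
          (\<lambda>k. l2_norm D (\<lambda>x. (\<Sum>i<N k. indicator (A k i) t *\<^sub>R g k i x) - f t x)) \<longlonglongrightarrow> 0)) \<and>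
     integrable (lebesgue_on {0..T}) (\<lambda>t. (l2_norm D (f t))\<^sup>2)"


section \<open>Finite element spaces\<close>

text \<open>A conforming triangulation of the closure of \<open>D\<close> with mesh size \<open>h\<close> (the largest triangle
  diameter), shape regular with constant \<open>\<sigma>\<close>: each triangle \<open>K\<close> contains a disc of radius
  \<open>diameter K / \<sigma>\<close>.\<close>

definition regular_partition :: "(real^2) set \<Rightarrow> real \<Rightarrow> real \<Rightarrow> (real^2) set set \<Rightarrow> bool" where
  "regular_partition D \<sigma> h \<K> \<longleftrightarrow>
     triangulation \<K> \<and> (\<forall>K\<in>\<K>. 2 simplex K) \<and> \<Union>\<K> = closure D \<and>
     h = Max (diameter ` \<K>) \<and>
     (\<forall>K\<in>\<K>. \<exists>x. cball x (diameter K / \<sigma>) \<subseteq> K)"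

definition regular_mesh_family :: "(real^2) set \<Rightarrow> real set \<Rightarrow> (real \<Rightarrow> (real^2) set set) \<Rightarrow> bool" where
  "regular_mesh_family D H \<T> \<longleftrightarrow>
     H \<subseteq> {0<..<1} \<and> (\<exists>\<sigma>>0. \<forall>h\<in>H. regular_partition D \<sigma> h (\<T> h))"

text \<open>\<open>is_poly d K p\<close>: on \<open>K\<close>, \<open>p\<close> is a polynomial of total degree at most \<open>d\<close>.\<close>

definition is_poly :: "nat \<Rightarrow> (real^2) set \<Rightarrow> (real^2 \<Rightarrow> real) \<Rightarrow> bool" where
  "is_poly d K p \<longleftrightarrow>
     (\<exists>c :: nat \<Rightarrow> nat \<Rightarrow> real. \<forall>x\<in>K. p x = (\<Sum>i\<le>d. \<Sum>j\<le>d - i. c i j * (x $ 1) ^ i * (x $ 2) ^ j))"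

definition Xh_space :: "(real^2) set \<Rightarrow> nat \<Rightarrow> (real^2) set set \<Rightarrow> (real^2 \<Rightarrow> real^2) set" where
  "Xh_space D r \<K> = {v. continuous_on (closure D) v \<and> v \<in> X_space D \<and>
                        (\<forall>K\<in>\<K>. \<forall>i. is_poly (r + 1) K (\<lambda>x. v x $ i))}"

definition Qh_space :: "(real^2) set \<Rightarrow> nat \<Rightarrow> (real^2) set set \<Rightarrow> (real^2 \<Rightarrow> real) set" where
  "Qh_space D r \<K> = {q. continuous_on (closure D) q \<and> q \<in> Q_space D \<and>
                        (\<forall>K\<in>\<K>. is_poly r K q)}"

definition Vh_space :: "(real^2) set \<Rightarrow> nat \<Rightarrow> (real^2) set set \<Rightarrow> (real^2 \<Rightarrow> real^2) set" where
  "Vh_space D r \<K> = {v \<in> Xh_space D r \<K>. \<forall>q\<in>Qh_space D r \<K>. l2_inner D (wdiv D v) q = 0}"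

text \<open>The constant \<open>C\<close> does not depend on \<open>h\<close>.  Being nonzero means being nonzero on \<open>D\<close>; the
  supremum is taken in the extended reals.\<close>

definition discrete_inf_sup :: "(real^2) set \<Rightarrow> nat \<Rightarrow> real set \<Rightarrow> (real \<Rightarrow> (real^2) set set) \<Rightarrow> bool" where
  "discrete_inf_sup D r H \<T> \<longleftrightarrow>
     (\<exists>C>0. \<forall>h\<in>H. \<forall>q\<in>Qh_space D r (\<T> h).
        ereal (l2_norm D q) \<le>
          ereal C * (SUP v\<in>{v \<in> Xh_space D r (\<T> h). \<exists>x\<in>D. v x \<noteq> 0}.
                       ereal (l2_inner D (wdiv D v) q / l2_norm D (wgrad D v))))"


section \<open>Time grid and DLN notation\<close>

definition time_grid :: "real \<Rightarrow> nat \<Rightarrow> (nat \<Rightarrow> real) \<Rightarrow> bool" where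
  "time_grid T M t \<longleftrightarrow> t 0 = 0 \<and> t M = T \<and> (\<forall>n<M. t n < t (n + 1))"

definition tstep :: "(nat \<Rightarrow> real) \<Rightarrow> nat \<Rightarrow> real" where
  "tstep t n = t (n + 1) - t n"

text \<open>All quantities below with a time index \<open>n\<close> are used for \<open>n \<ge> 1\<close> only.\<close>

definition step_var :: "(nat \<Rightarrow> real) \<Rightarrow> nat \<Rightarrow> real" where
  "step_var t n = (tstep t n - tstep t (n - 1)) / (tstep t n + tstep t (n - 1))"

text \<open>The coefficients \<open>\<alpha>\<^sub>l\<close>, \<open>\<beta>\<^sub>l\<close>, \<open>a\<^sub>l\<close> for \<open>l = 0, 1, 2\<close>; the argument \<open>e\<close> is
  the step variability \<open>\<epsilon>\<^sub>n\<close>.\<close>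

definition dln_alpha :: "real \<Rightarrow> nat \<Rightarrow> real" where
  "dln_alpha \<theta> l =
     (if l = 0 then (\<theta> - 1) / 2 else if l = 1 then - \<theta> else (\<theta> + 1) / 2)"

definition dln_beta :: "real \<Rightarrow> real \<Rightarrow> nat \<Rightarrow> real" where
  "dln_beta \<theta> e l =
     (if l = 0 then
        1/4 * (1 + (1 - \<theta>\<^sup>2) / (1 + e * \<theta>)\<^sup>2 - e\<^sup>2 * (\<theta> * (1 - \<theta>\<^sup>2) / (1 + e * \<theta>)\<^sup>2) - \<theta>)
      else if l = 1 then
        1/2 * (1 - (1 - \<theta>\<^sup>2) / (1 + e * \<theta>)\<^sup>2)
      else
        1/4 * (1 + (1 - \<theta>\<^sup>2) / (1 + e * \<theta>)\<^sup>2 + e\<^sup>2 * (\<theta> * (1 - \<theta>\<^sup>2) / (1 + e * \<theta>)\<^sup>2) + \<theta>))"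

definition dln_a1 :: "real \<Rightarrow> real \<Rightarrow> real" where
  "dln_a1 \<theta> e = - (sqrt (\<theta> * (1 - \<theta>\<^sup>2)) / (sqrt 2 * (1 + e * \<theta>)))"

definition dln_a :: "real \<Rightarrow> real \<Rightarrow> nat \<Rightarrow> real" where
  "dln_a \<theta> e l =
     (if l = 0 then - ((1 + e) / 2) * dln_a1 \<theta> e
      else if l = 1 then dln_a1 \<theta> e
      else - ((1 - e) / 2) * dln_a1 \<theta> e)"

definition avg_step :: "real \<Rightarrow> (nat \<Rightarrow> real) \<Rightarrow> nat \<Rightarrow> real" where
  "avg_step \<theta> t n = dln_alpha \<theta> 2 * tstep t n - dln_alpha \<theta> 0 * tstep t (n - 1)"

definition C_beta :: "real \<Rightarrow> (nat \<Rightarrow> real) \<Rightarrow> nat \<Rightarrow> real" where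
  "C_beta \<theta> t n = (\<Sum>l\<le>2. (dln_beta \<theta> (step_var t n) l)\<^sup>2)"

definition three_point ::
  "(nat \<Rightarrow> real) \<Rightarrow> (nat \<Rightarrow> real^2 \<Rightarrow> 'b::real_vector) \<Rightarrow> nat \<Rightarrow> real^2 \<Rightarrow> 'b" where
  "three_point c z n = (\<lambda>x. \<Sum>l\<le>2. c l *\<^sub>R z (n - 1 + l) x)"

definition alpha_comb ::
  "real \<Rightarrow> (nat \<Rightarrow> real^2 \<Rightarrow> 'b::real_vector) \<Rightarrow> nat \<Rightarrow> real^2 \<Rightarrow> 'b" where
  "alpha_comb \<theta> z n = three_point (dln_alpha \<theta>) z n"

definition beta_comb ::
  "real \<Rightarrow> (nat \<Rightarrow> real) \<Rightarrow> (nat \<Rightarrow> real^2 \<Rightarrow> 'b::real_vector) \<Rightarrow> nat \<Rightarrow> real^2 \<Rightarrow> 'b" where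
  "beta_comb \<theta> t z n = three_point (dln_beta \<theta> (step_var t n)) z n"

definition a_comb ::
  "real \<Rightarrow> (nat \<Rightarrow> real) \<Rightarrow> (nat \<Rightarrow> real^2 \<Rightarrow> 'b::real_vector) \<Rightarrow> nat \<Rightarrow> real^2 \<Rightarrow> 'b" where
  "a_comb \<theta> t z n = three_point (dln_a \<theta> (step_var t n)) z n"


section \<open>The fully discrete DLN scheme\<close>

definition dln_momentum_eq ::
  "(real^2) set \<Rightarrow> real \<Rightarrow> real \<Rightarrow> real \<Rightarrow> real \<Rightarrow> real \<Rightarrow> real \<Rightarrow> (nat \<Rightarrow> real) \<Rightarrow>
   (real \<Rightarrow> real^2 \<Rightarrow> real^2) \<Rightarrow> (nat \<Rightarrow> real^2 \<Rightarrow> real^2) \<Rightarrow> (nat \<Rightarrow> real^2 \<Rightarrow> real^2) \<Rightarrow>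
   (nat \<Rightarrow> real^2 \<Rightarrow> real) \<Rightarrow> nat \<Rightarrow> (real^2 \<Rightarrow> real^2) \<Rightarrow> bool" where
  "dln_momentum_eq D \<mu> \<gamma> \<nu> lam \<rho> \<theta> t f u w p n v \<longleftrightarrow>
     (let ub = beta_comb \<theta> t u n; wb = beta_comb \<theta> t w n; pb = beta_comb \<theta> t p n in
        1 / avg_step \<theta> t n * l2_inner D (alpha_comb \<theta> u n) v
        + \<mu> * l2_inner D (wgrad D ub) (wgrad D v)
        + \<gamma> * l2_inner D (wgrad D wb) (wgrad D v)
        + \<nu> * trilin_b D ub ub v
        + \<rho> * l2_inner D ub v
        + lam * l2_inner D (\<lambda>x. (norm (ub x))\<^sup>2 *\<^sub>R ub x) v
        - l2_inner D pb (wdiv D v)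
        = l2_inner D (beta_comb \<theta> t (\<lambda>n. f (t n)) n) v)"

text \<open>The last two equations are required at every time level, the starting levels \<open>0\<close> and \<open>1\<close>
  included.\<close>

definition dln_solution ::
  "(real^2) set \<Rightarrow> nat \<Rightarrow> (real^2) set set \<Rightarrow> real \<Rightarrow> real \<Rightarrow> real \<Rightarrow> real \<Rightarrow> real \<Rightarrow> real \<Rightarrow>
   nat \<Rightarrow> (nat \<Rightarrow> real) \<Rightarrow> (real \<Rightarrow> real^2 \<Rightarrow> real^2) \<Rightarrow> (nat \<Rightarrow> real^2 \<Rightarrow> real^2) \<Rightarrow>
   (nat \<Rightarrow> real^2 \<Rightarrow> real^2) \<Rightarrow> (nat \<Rightarrow> real^2 \<Rightarrow> real) \<Rightarrow> bool" where
  "dln_solution D r \<K> \<mu> \<gamma> \<nu> lam \<rho> \<theta> M t f u w p \<longleftrightarrow>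
     (\<forall>n\<le>M. u n \<in> Xh_space D r \<K> \<and> w n \<in> Vh_space D r \<K> \<and> p n \<in> Qh_space D r \<K>) \<and>
     (\<forall>n\<in>{1..<M}. \<forall>v\<in>Xh_space D r \<K>. dln_momentum_eq D \<mu> \<gamma> \<nu> lam \<rho> \<theta> t f u w p n v) \<and>
     (\<forall>n\<le>M. \<forall>\<phi>\<in>Vh_space D r \<K>. l2_inner D (w n) \<phi> = l2_inner D (wgrad D (u n)) (wgrad D \<phi>)) \<and>
     (\<forall>n\<le>M. \<forall>q\<in>Qh_space D r \<K>. l2_inner D (wdiv D (u n)) q = 0)"

end

theory Submission
  imports Defs
begin

text \<open>
  The estimate is an energy estimate: the momentum equation is tested with \<open>v = u\<^bsub>n,\<beta>\<^esub>\<close>.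
  The convective term disappears by skew-symmetry, the cubic term becomes the fourth power of the
  \<open>L\<^sup>4\<close> norm, the pressure term vanishes because all \<open>u\<^sub>i\<close> are discretely divergence free, and the
  vorticity relation tested with \<open>w\<^bsub>n,\<beta>\<^esub>\<close> turns the \<open>\<gamma>\<close> term into \<open>\<gamma> \<parallel>w\<^bsub>n,\<beta>\<^esub>\<parallel>\<^sup>2\<close>.  The discrete time
  derivative is handled by the G-stability identity (\<open>dln_G_identity\<close>): with the energy
  \<open>E\<^sub>n = (1+\<theta>)/4 \<parallel>u\<^sub>n\<parallel>\<^sup>2 + (1-\<theta>)/4 \<parallel>u\<^bsub>n-1\<^esub>\<parallel>\<^sup>2\<close>, the product of the \<open>\<alpha>\<close> and the \<open>\<beta>\<close> combination is
  \<open>E\<^bsub>n+1\<^esub> - E\<^sub>n\<close> plus the numerical dissipation, a square.  This gives \<open>dln_energy_balance\<close>.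

  The forcing is absorbed into half of the viscous dissipation by the Poincare inequality
  (\<open>poincare_X\<close>), whose constant depends on \<open>D\<close> alone; half of it serves as the
  constant \<open>C\<close> of the theorem.

  The reaction term contributes at most \<open>\<bar>\<rho>\<bar> k \<parallel>u\<^bsub>n,\<beta>\<^esub>\<parallel>\<^sup>2\<close>, where \<open>k\<close> is the averaged step.  It contains
  the unknown \<open>u\<^bsub>n+1\<^esub>\<close>, and under the step size restriction the crude bound of
  \<open>\<parallel>u\<^bsub>n,\<beta>\<^esub>\<parallel>\<^sup>2\<close> by the sum of the \<open>\<beta>\<^sub>l\<^sup>2\<close> times the sum of the \<open>\<parallel>u\<^sub>i\<parallel>\<^sup>2\<close> would
  allow it to consume the whole energy on the left: equality is admitted in the restriction.  The
  way out is that \<open>\<beta>\<^sub>0\<^sup>2 + \<beta>\<^sub>1\<^sup>2\<close> is bounded away from \<open>0\<close> uniformly in the step ratio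
  (\<open>dln_beta_bounds\<close>), so that \<open>\<beta>\<^sub>2\<^sup>2\<close> is a fixed fraction smaller than \<open>C\<^sub>\<beta>\<close>; a weighted Young
  inequality then leaves a fixed share of \<open>E\<^bsub>n+1\<^esub>\<close> (\<open>dln_growth_rate_exists\<close>).  The resulting one-step
  growth factor \<open>exp (\<Lambda> \<bar>\<rho>\<bar> k)\<close> depends only on \<open>\<theta>\<close> and on \<open>\<bar>\<rho>\<bar> k\<close>, and \<open>discrete_gronwall\<close> concludes,
  since the averaged steps sum to at most \<open>T\<close>.

  Using \<open>u\<^bsub>n,\<beta>\<^esub>\<close> as a test function requires that the finite element spaces are linear and that weak
  gradients depend linearly on the function.  As the weak gradient is a selected representative, this
  rests on its uniqueness almost everywhere (\<open>has_weak_grad_unique\<close>), hence on the fundamental lemma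
  of the calculus of variations (\<open>AE_zero_if_orthogonal_to_C1_compact\<close>).  Integration by parts for
  test functions (\<open>integral_grad_eq_0\<close>) identifies their weak gradients with the classical ones and
  is the source of the Poincare inequality.
\<close>

section \<open>Continuously differentiable functions with compact support\<close>

definition grad :: "(real^2 \<Rightarrow> real) \<Rightarrow> real^2 \<Rightarrow> real^2" where
  "grad \<phi> x = (\<chi> j. frechet_derivative \<phi> (at x) (axis j 1))"

text \<open>Stating differentiability through the total function \<open>grad\<close> makes the derivative a function of
  \<open>\<phi>\<close>, so that calculus rules become equations between gradients.\<close>

definition C1_fun :: "(real^2 \<Rightarrow> real) \<Rightarrow> bool" where
  "C1_fun \<phi> \<longleftrightarrow> continuous_on UNIV (grad \<phi>) \<and> (\<forall>x. (\<phi> has_derivative (\<lambda>y. grad \<phi> x \<bullet> y)) (at x))"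

lemma grad_eqI: "(\<phi> has_derivative (\<lambda>y. g \<bullet> y)) (at x) \<Longrightarrow> grad \<phi> x = g"
proof -
  assume "(\<phi> has_derivative (\<lambda>y. g \<bullet> y)) (at x)"
  from frechet_derivative_at[OF this, symmetric] show ?thesis
    by (simp add: grad_def vec_eq_iff inner_axis)
qed

lemma C1_funI:
  assumes "\<And>x. (\<phi> has_derivative (\<lambda>y. g x \<bullet> y)) (at x)" "continuous_on UNIV g"
  shows "C1_fun \<phi>" "grad \<phi> = g"
proof -
  show "grad \<phi> = g" using grad_eqI assms by blast
  then show "C1_fun \<phi>" using assms by (simp add: C1_fun_def)
qed

lemma C1_compact_iff:
  "\<phi> \<in> C1_compact D \<longleftrightarrow>
     C1_fun \<phi> \<and> compact (closure {x. \<phi> x \<noteq> 0}) \<and> closure {x. \<phi> x \<noteq> 0} \<subseteq> D"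
proof -
  have "(\<exists>g. continuous_on UNIV g \<and> (\<forall>x. (\<phi> has_derivative (\<lambda>y. g x \<bullet> y)) (at x))) \<longleftrightarrow> C1_fun \<phi>"
    using C1_funI(1)[of \<phi>] unfolding C1_fun_def by blast
  then show ?thesis by (simp add: C1_compact_def)
qed

lemma C1_fun_continuous: "C1_fun \<phi> \<Longrightarrow> continuous_on S \<phi>"
  unfolding C1_fun_def
  by (meson differentiable_def differentiable_imp_continuous_on differentiable_at_imp_differentiable_on)

lemma C1_fun_lincomb:
  assumes "C1_fun \<phi>" "C1_fun \<psi>"
  shows "C1_fun (\<lambda>x. a * \<phi> x + b * \<psi> x)"
proof (rule C1_funI)
  show "((\<lambda>x. a * \<phi> x + b * \<psi> x) has_derivative (\<lambda>y. (a *\<^sub>R grad \<phi> x + b *\<^sub>R grad \<psi> x) \<bullet> y)) (at x)" for x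
    using assms unfolding C1_fun_def
    by (auto intro!: derivative_eq_intros simp: inner_add_left)
  show "continuous_on UNIV (\<lambda>x. a *\<^sub>R grad \<phi> x + b *\<^sub>R grad \<psi> x)"
    using assms unfolding C1_fun_def by (intro continuous_intros) auto
qed

lemma C1_fun_mult:
  assumes "C1_fun \<phi>" "C1_fun \<psi>"
  shows "C1_fun (\<lambda>x. \<phi> x * \<psi> x)"
    and "grad (\<lambda>x. \<phi> x * \<psi> x) = (\<lambda>x. \<psi> x *\<^sub>R grad \<phi> x + \<phi> x *\<^sub>R grad \<psi> x)"
proof -
  have 1: "((\<lambda>x. \<phi> x * \<psi> x) has_derivative (\<lambda>y. (\<psi> x *\<^sub>R grad \<phi> x + \<phi> x *\<^sub>R grad \<psi> x) \<bullet> y)) (at x)" for x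
    using assms unfolding C1_fun_def
    by (auto intro!: derivative_eq_intros simp: inner_add_left)
  have 2: "continuous_on UNIV (\<lambda>x. \<psi> x *\<^sub>R grad \<phi> x + \<phi> x *\<^sub>R grad \<psi> x)"
    using assms C1_fun_continuous unfolding C1_fun_def by (intro continuous_intros) (auto simp: C1_fun_def)
  show "C1_fun (\<lambda>x. \<phi> x * \<psi> x)"
    "grad (\<lambda>x. \<phi> x * \<psi> x) = (\<lambda>x. \<psi> x *\<^sub>R grad \<phi> x + \<phi> x *\<^sub>R grad \<psi> x)"
    using C1_funI[OF 1 2] by blast+
qed

lemma C1_fun_component: "C1_fun (\<lambda>x. x $ i)" "grad (\<lambda>x. x $ i) = (\<lambda>_. axis i 1)"
proof -
  have 1: "((\<lambda>x::real^2. x $ i) has_derivative (\<lambda>y. axis i 1 \<bullet> y)) (at x)" for x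
    using bounded_linear_imp_has_derivative[OF bounded_linear_vec_nth[of i]]
    by (simp add: inner_axis')
  show "C1_fun (\<lambda>x. x $ i)" "grad (\<lambda>x. x $ i) = (\<lambda>_. axis i 1)"
    using C1_funI[OF 1 continuous_on_const] by blast+
qed

lemma C1_fun_compose:
  assumes "C1_fun \<phi>" "\<And>t. (s has_real_derivative s' t) (at t)" "continuous_on UNIV s'"
  shows "C1_fun (\<lambda>x. s (\<phi> x))"
proof (rule C1_funI)
  show "((\<lambda>x. s (\<phi> x)) has_derivative (\<lambda>y. (s' (\<phi> x) *\<^sub>R grad \<phi> x) \<bullet> y)) (at x)" for x
    using has_derivative_compose[of \<phi> "\<lambda>y. grad \<phi> x \<bullet> y" x UNIV s "\<lambda>y. s' (\<phi> x) * y"] assms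
    by (auto simp: C1_fun_def has_field_derivative_def)
  show "continuous_on UNIV (\<lambda>x. s' (\<phi> x) *\<^sub>R grad \<phi> x)"
    using assms(1)
    by (intro continuous_on_scaleR continuous_on_compose2[OF assms(3)] C1_fun_continuous)
       (simp_all add: C1_fun_def)
qed

lemma C1_compact_lincomb:
  assumes "\<phi> \<in> C1_compact D" "\<psi> \<in> C1_compact D"
  shows "(\<lambda>x. a * \<phi> x + b * \<psi> x) \<in> C1_compact D"
proof -
  let ?c = "closure {x. a * \<phi> x + b * \<psi> x \<noteq> 0}"
  have "?c \<subseteq> closure ({x. \<phi> x \<noteq> 0} \<union> {x. \<psi> x \<noteq> 0})"
    by (rule closure_mono) auto
  then have s: "?c \<subseteq> closure {x. \<phi> x \<noteq> 0} \<union> closure {x. \<psi> x \<noteq> 0}"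
    by (simp add: closure_Un)
  then have "bounded ?c"
    using assms bounded_subset[OF _ s] by (simp add: C1_compact_iff compact_imp_bounded)
  then have "compact ?c"
    by (simp add: compact_eq_bounded_closed)
  then show ?thesis
    using assms s C1_fun_lincomb[of \<phi> \<psi> a b] by (auto simp: C1_compact_iff)
qed

text \<open>Products of a test function with a \<open>C\<^sup>1\<close> function, and compositions with functions that vanish at
  \<open>0\<close>, are test functions by this criterion.\<close>

lemma C1_compact_subsupport:
  assumes "\<phi> \<in> C1_compact D" "C1_fun \<psi>" "\<And>x. \<phi> x = 0 \<Longrightarrow> \<psi> x = 0"
  shows "\<psi> \<in> C1_compact D"
proof -
  have s: "closure {x. \<psi> x \<noteq> 0} \<subseteq> closure {x. \<phi> x \<noteq> 0}"
    using assms(3) by (intro closure_mono) auto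
  then have "compact (closure {x. \<psi> x \<noteq> 0})"
    using assms(1) bounded_subset[OF _ s] by (simp add: C1_compact_iff compact_eq_bounded_closed)
  then show ?thesis using s assms by (auto simp: C1_compact_iff)
qed

lemma grad_eq_0_outside_support:
  assumes "x \<notin> closure {x. \<phi> x \<noteq> 0}"
  shows "grad \<phi> x = 0"
proof (rule grad_eqI)
  let ?S = "- closure {x. \<phi> x \<noteq> 0}"
  have "\<phi> y = 0" if "y \<in> ?S" for y
    using that closure_subset[of "{x. \<phi> x \<noteq> 0}"] by blast
  moreover have "((\<lambda>x. 0) has_derivative (\<lambda>y. 0 \<bullet> y)) (at x)" by simp
  moreover have "open ?S" "x \<in> ?S" using assms by auto
  ultimately show "(\<phi> has_derivative (\<lambda>y. 0 \<bullet> y)) (at x)"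
    by (metis (mono_tags, lifting) has_derivative_transform_within_open)
qed

lemma lborel_integral_translate:
  fixes f :: "'a::euclidean_space \<Rightarrow> real"
  assumes "f \<in> borel_measurable borel"
  shows "(\<integral>x. f (c + x) \<partial>lborel) = (\<integral>x. f x \<partial>lborel)"
proof -
  have "(\<integral>x. f x \<partial>lborel) = (\<integral>x. f x \<partial>(distr lborel borel ((+) c)))"
    by (simp add: lborel_distr_plus)
  also have "\<dots> = (\<integral>x. f (c + x) \<partial>lborel)"
    using assms by (intro integral_distr) auto
  finally show ?thesis by simp
qed

lemma integral_lebesgue_on_borel:
  fixes h :: "'a::euclidean_space \<Rightarrow> real"
  assumes "D \<in> sets borel" "h \<in> borel_measurable borel" "\<And>x. x \<notin> D \<Longrightarrow> h x = 0"
  shows "(\<integral>x. h x \<partial>lebesgue_on D) = (\<integral>x. h x \<partial>lborel)"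
proof -
  have "(\<integral>x. h x \<partial>lebesgue_on D) = (\<integral>x. indicator D x *\<^sub>R h x \<partial>lebesgue)"
    using assms by (intro integral_restrict_space) auto
  also have "\<dots> = (\<integral>x. h x \<partial>lebesgue)"
    using assms(3) by (intro Bochner_Integration.integral_cong) (auto simp: indicator_def)
  also have "\<dots> = (\<integral>x. h x \<partial>lborel)"
    using assms(2) by (intro integral_completion) auto
  finally show ?thesis .
qed

text \<open>The difference quotients of \<open>\<phi>\<close> in a fixed direction have integral \<open>0\<close> by translation invariance,
  they converge to the partial derivative, and the global Lipschitz bound together with the compact
  support yields an integrable majorant.\<close>

lemma integral_grad_eq_0:
  assumes "\<phi> \<in> C1_compact D"
  shows "(\<integral>x. grad \<phi> x $ j \<partial>lborel) = 0"
proof -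
  define K where "K = closure {x. \<phi> x \<noteq> 0}"
  have K: "compact K" and C1: "C1_fun \<phi>"
    using assms by (auto simp: K_def C1_compact_iff)
  have cont: "continuous_on UNIV (grad \<phi>)" and der: "\<And>x. (\<phi> has_derivative (\<lambda>y. grad \<phi> x \<bullet> y)) (at x)"
    using C1 by (auto simp: C1_fun_def)
  have zero: "grad \<phi> x = 0" "\<phi> x = 0" if "x \<notin> K" for x
    using that grad_eq_0_outside_support[of x \<phi>] closure_subset[of "{x. \<phi> x \<noteq> 0}"]
    by (auto simp: K_def)
  obtain R where R: "K \<subseteq> ball 0 R"
    using K bounded_subset_ballD[OF compact_imp_bounded] by metis
  have "compact (grad \<phi> ` K)"
    using K cont by (intro compact_continuous_image) (auto intro: continuous_on_subset)
  then obtain B where "\<And>x. x \<in> K \<Longrightarrow> norm (grad \<phi> x) \<le> B" and "B > 0"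
    by (metis bounded_pos compact_imp_bounded imageI)
  then have B: "norm (grad \<phi> x) \<le> B" for x
    by (cases "x \<in> K") (auto simp: zero)
  have lip: "\<bar>\<phi> x - \<phi> y\<bar> \<le> B * norm (x - y)" for x y
  proof -
    have "onorm (\<lambda>y. grad \<phi> x \<bullet> y) \<le> B" for x
      using order_trans[OF Cauchy_Schwarz_ineq2 mult_right_mono[OF B]] by (intro onorm_le) simp
    then show ?thesis
      using differentiable_bound[of UNIV \<phi> "\<lambda>x y. grad \<phi> x \<bullet> y" B x y] der by auto
  qed
  define e :: "real^2" where "e = axis j 1"
  define t where "t n = 1 / real (Suc n)" for n
  define q where "q n x = (\<phi> (t n *\<^sub>R e + x) - \<phi> x) / t n" for n x
  have t: "t n > 0" "t n \<le> 1" for n by (auto simp: t_def)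
  have e: "norm e = 1" by (simp add: e_def)
  have cphi: "continuous_on UNIV \<phi>" by (rule C1_fun_continuous[OF C1])
  have mphi: "\<phi> \<in> borel_measurable borel"
    using cphi by (rule borel_measurable_continuous_onI)
  have int: "integrable lborel \<phi>"
  proof -
    have "integrable lborel (\<lambda>x. indicator K x *\<^sub>R \<phi> x)"
      using K cphi by (intro borel_integrable_compact) (auto intro: continuous_on_subset)
    moreover have "(\<lambda>x. indicator K x *\<^sub>R \<phi> x) = \<phi>"
      using zero by (auto simp: fun_eq_iff indicator_def)
    ultimately show ?thesis by simp
  qed
  have int': "integrable lborel (\<lambda>x. \<phi> (c + x))" for c
  proof -
    have "integrable (distr lborel borel ((+) c)) \<phi>" using int by (simp add: lborel_distr_plus)
    then show ?thesis by (subst (asm) integrable_distr_eq) (use mphi in auto)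
  qed
  have q0: "(\<integral>x. q n x \<partial>lborel) = 0" for n
    unfolding q_def using int int' lborel_integral_translate[OF mphi] by simp
  have lim: "(\<lambda>n. q n x) \<longlonglongrightarrow> grad \<phi> x $ j" for x
  proof -
    have "((\<lambda>s. \<phi> (x + s *\<^sub>R e)) has_real_derivative (grad \<phi> x \<bullet> e)) (at 0)"
    proof -
      have "((\<lambda>s::real. x + s *\<^sub>R e) has_derivative (\<lambda>s. s *\<^sub>R e)) (at 0)"
        by (auto intro!: derivative_eq_intros)
      from has_derivative_compose[OF this, of \<phi> "\<lambda>y. grad \<phi> x \<bullet> y"] der show ?thesis
        by (simp add: has_field_derivative_def mult.commute[of _ "grad \<phi> x \<bullet> e"])
    qed
    then have "((\<lambda>h. (\<phi> (x + h *\<^sub>R e) - \<phi> x) / h) \<longlongrightarrow> grad \<phi> x \<bullet> e) (at 0)"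
      by (simp add: DERIV_def)
    moreover have "filterlim t (at 0) sequentially"
      unfolding filterlim_at using t LIMSEQ_inverse_real_of_nat
      by (auto simp: t_def[abs_def] inverse_eq_divide intro!: always_eventually)
    ultimately have "(\<lambda>n. (\<phi> (x + t n *\<^sub>R e) - \<phi> x) / t n) \<longlonglongrightarrow> grad \<phi> x \<bullet> e"
      by (rule filterlim_compose)
    then show ?thesis by (simp add: q_def e_def inner_axis add.commute)
  qed
  have bound: "norm (q n x) \<le> indicator (cball 0 (R + 1)) x *\<^sub>R B" for n x
  proof (cases "x \<in> cball 0 (R + 1)")
    case True
    have "\<bar>\<phi> (t n *\<^sub>R e + x) - \<phi> x\<bar> \<le> B * t n"
      using lip[of "t n *\<^sub>R e + x" x] t[of n] e by simp
    then show ?thesis using True t[of n] by (simp add: q_def field_simps)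
  next
    case False
    have "norm x \<le> norm (t n *\<^sub>R e + x) + norm (t n *\<^sub>R e)"
      by (metis add.commute add_diff_cancel_right' norm_triangle_ineq4)
    then have "norm (t n *\<^sub>R e + x) > R" "norm x > R" using False t[of n] e by auto
    then have "t n *\<^sub>R e + x \<notin> K" "x \<notin> K" using R by force+
    then show ?thesis using False by (simp add: q_def zero)
  qed
  have "(\<lambda>n. \<integral>x. q n x \<partial>lborel) \<longlonglongrightarrow> (\<integral>x. grad \<phi> x $ j \<partial>lborel)"
  proof (rule integral_dominated_convergence[where w = "\<lambda>x. indicator (cball 0 (R + 1)) x *\<^sub>R B"])
    show "integrable lborel (\<lambda>x::real^2. indicator (cball 0 (R + 1)) x *\<^sub>R B)"
      by (intro borel_integrable_compact) auto
    show "(\<lambda>x. grad \<phi> x $ j) \<in> borel_measurable lborel"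
      using cont by (simp add: borel_measurable_continuous_onI continuous_on_component)
    show "q n \<in> borel_measurable lborel" for n
      unfolding q_def[abs_def] using int int'
      by (intro borel_measurable_divide borel_measurable_diff borel_measurable_integrable) auto
  qed (use lim bound in auto)
  then show ?thesis by (simp add: q0 LIMSEQ_const_iff)
qed

section \<open>Uniqueness of weak gradients\<close>

text \<open>Boxes form an intersection-stable generator of the Borel sets, so the integral of \<open>f\<close> vanishes over
  every Borel set.\<close>

lemma AE_zero_if_box_integrals_zero:
  fixes f :: "'a::euclidean_space \<Rightarrow> real"
  assumes f: "integrable lborel f"
    and box: "\<And>a b. (\<integral>x. indicator (box a b) x * f x \<partial>lborel) = 0"
    and total: "(\<integral>x. f x \<partial>lborel) = 0"
  shows "AE x in lborel. f x = 0"
proof (rule sigma_finite_measure.density_zero[OF sigma_finite_lborel f])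
  have B: "sets (borel :: 'a measure) = sigma_sets UNIV (range (\<lambda>(a,b). box a b :: 'a set))"
    by (subst borel_eq_box) simp
  fix A :: "'a set" assume "A \<in> sets lborel"
  then have A: "A \<in> sigma_sets UNIV (range (\<lambda>(a,b). box a b :: 'a set))"
    by (simp add: B)
  have fI: "set_integrable lborel A f" if "A \<in> sets borel" for A
    using integrable_mult_indicator[of A lborel f] that f by (simp add: set_integrable_def)
  have borelI: "A \<in> sets borel" if "A \<in> sigma_sets UNIV (range (\<lambda>(a,b). box a b :: 'a set))" for A
    using that by (simp add: B)
  have stable: "Int_stable (range (\<lambda>(a,b). box a b :: 'a set))"
    by (force simp: Int_stable_def box_Int_box)
  have sub: "range (\<lambda>(a,b). box a b :: 'a set) \<subseteq> Pow UNIV" by simp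
  from stable sub A show "(LINT x:A|lborel. f x) = 0"
  proof (induct rule: sigma_sets_induct_disjoint)
    case (basic A)
    then show ?case using box by (auto simp: set_lebesgue_integral_def)
  next
    case empty
    then show ?case by (simp add: set_lebesgue_integral_def)
  next
    case (compl A)
    have "(LINT x:(UNIV - A) \<union> A|lborel. f x) = (LINT x:UNIV - A|lborel. f x) + (LINT x:A|lborel. f x)"
      using borelI[OF compl(1)] fI by (intro set_integral_Un) auto
    then show ?case using compl total by (simp add: set_lebesgue_integral_def)
  next
    case (union A)
    have Ai: "A i \<in> sets borel" for i using union(2) by (intro borelI) auto
    have "(LINT x:(\<Union>i. A i)|lborel. f x) = (\<Sum>i. (LINT x:(A i)|lborel. f x))"
      using union fI Ai
      by (intro lebesgue_integral_countable_add)
         (auto simp: disjoint_family_on_def)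
    then show ?case using union by simp
  qed
qed

text \<open>A \<open>C\<^sup>1\<close> function that is positive exactly on the positive half-line.\<close>

definition sq_pos :: "real \<Rightarrow> real" where "sq_pos t = (max 0 t)\<^sup>2"

lemma sq_pos_deriv: "(sq_pos has_real_derivative 2 * max 0 t) (at t)"
proof -
  consider "t > 0" | "t < 0" | "t = 0" by linarith
  then show ?thesis
  proof cases
    case 1
    have "((\<lambda>t. t\<^sup>2) has_real_derivative 2 * max 0 t) (at t)"
      using 1 by (auto intro!: derivative_eq_intros)
    then show ?thesis
      by (rule has_field_derivative_transform_within_open[where S = "{0<..}"]) (use 1 in \<open>auto simp: sq_pos_def\<close>)
  next
    case 2
    have "((\<lambda>t. 0) has_real_derivative 2 * max 0 t) (at t)"
      using 2 by auto
    then show ?thesis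
      by (rule has_field_derivative_transform_within_open[where S = "{..<0}"]) (use 2 in \<open>auto simp: sq_pos_def\<close>)
  next
    case 3
    have "isCont (max 0) (0::real)" by (intro continuous_intros)
    moreover have "sq_pos z - sq_pos 0 = max 0 z * (z - 0)" for z
      by (auto simp: sq_pos_def max_def power2_eq_square)
    ultimately show ?thesis unfolding CARAT_DERIV using 3 by (intro exI[of _ "max 0"]) auto
  qed
qed

lemma sq_pos_eq_0: "sq_pos t = 0 \<longleftrightarrow> t \<le> 0"
  by (auto simp: sq_pos_def max_def)

text \<open>The product of \<open>sq_pos\<close> of the four signed distances to the sides of the box.\<close>

lemma box_bump_exists:
  assumes "cbox a b \<subseteq> D"
  obtains h where "h \<in> C1_compact D" "{x. h x \<noteq> 0} = box a b"
proof -
  define l where "l i x = sq_pos (x $ i - a $ i)" for i and x :: "real^2"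
  define u where "u i x = sq_pos (b $ i - x $ i)" for i and x :: "real^2"
  have "C1_fun (l i)" for i
    unfolding l_def
    by (rule C1_fun_compose[OF C1_fun_component(1), where s' = "\<lambda>t. 2 * max 0 (t - a $ i)"])
       (auto intro!: DERIV_chain2[OF sq_pos_deriv, THEN DERIV_cong] derivative_eq_intros continuous_intros)
  moreover have "C1_fun (u i)" for i
    unfolding u_def
    by (rule C1_fun_compose[OF C1_fun_component(1), where s' = "\<lambda>t. - (2 * max 0 (b $ i - t))"])
       (auto intro!: DERIV_chain2[OF sq_pos_deriv, THEN DERIV_cong] derivative_eq_intros continuous_intros)
  ultimately have C1: "C1_fun (\<lambda>x. (l 1 x * u 1 x) * (l 2 x * u 2 x))"
    by (intro C1_fun_mult(1))
  have s: "{x. (l 1 x * u 1 x) * (l 2 x * u 2 x) \<noteq> 0} = box a b"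
    by (auto simp: l_def u_def sq_pos_eq_0 mem_box_cart forall_2)
  have c: "closure (box a b) \<subseteq> cbox a b"
    by (simp add: closure_minimal box_subset_cbox closed_cbox)
  then have "compact (closure (box a b))"
    using bounded_subset[OF bounded_cbox c] by (simp add: compact_eq_bounded_closed)
  then show thesis
    using C1 s c assms by (intro that[of "\<lambda>x. (l 1 x * u 1 x) * (l 2 x * u 2 x)"]) (auto simp: C1_compact_iff)
qed

text \<open>As \<open>k\<close> grows, these test functions increase to the indicator function of \<open>{x. \<phi> x \<noteq> 0}\<close>.\<close>

lemma C1_compact_support_cutoff:
  assumes \<phi>: "\<phi> \<in> C1_compact D" and "k \<ge> 0"
  shows "(\<lambda>x. k * (\<phi> x)\<^sup>2 / (1 + k * (\<phi> x)\<^sup>2)) \<in> C1_compact D"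
proof (rule C1_compact_subsupport[OF \<phi>])
  have pos: "1 + k * t\<^sup>2 > 0" for t :: real
    using assms(2) by (simp add: add_pos_nonneg)
  then have nz: "1 + k * t\<^sup>2 \<noteq> 0" for t :: real
    by (metis less_irrefl)
  have C1: "C1_fun \<phi>" using assms by (simp add: C1_compact_iff)
  have deriv: "((\<lambda>t. k * t\<^sup>2 / (1 + k * t\<^sup>2)) has_real_derivative 2 * k * t / (1 + k * t\<^sup>2)\<^sup>2) (at t)" for t
    using nz[of t] by (auto intro!: derivative_eq_intros simp: divide_simps) (simp add: algebra_simps power2_eq_square)
  show "C1_fun (\<lambda>x. k * (\<phi> x)\<^sup>2 / (1 + k * (\<phi> x)\<^sup>2))"
    using nz by (intro C1_fun_compose[OF C1 deriv] continuous_intros) auto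
qed auto

lemma C1_compact_measurable_lebesgue_on:
  assumes "\<phi> \<in> C1_compact D" shows "\<phi> \<in> borel_measurable (lebesgue_on S)"
proof -
  have "\<phi> \<in> borel_measurable borel"
    using assms C1_fun_continuous by (intro borel_measurable_continuous_onI) (auto simp: C1_compact_iff)
  then show ?thesis by (simp add: measurable_completion measurable_restrict_space1)
qed

text \<open>The fundamental lemma of the calculus of variations.  Boxes whose closure lies in \<open>D\<close> are supports
  of bump functions, whose cutoffs converge to the indicator function of the box; therefore \<open>g\<close> has
  integral \<open>0\<close> over all such boxes, and it vanishes almost everywhere in each of countably many closed
  boxes that cover \<open>D\<close>.\<close>

lemma AE_zero_if_orthogonal_to_C1_compact:
  assumes D: "open D" and g: "integrable (lebesgue_on D) g"
    and orth: "\<And>\<phi>. \<phi> \<in> C1_compact D \<Longrightarrow> (\<integral>x. g x * \<phi> x \<partial>lebesgue_on D) = 0"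
  shows "AE x in lebesgue_on D. g x = 0"
proof -
  have Dm: "D \<in> sets lebesgue" using D by auto
  have support: "(\<integral>x. g x * indicator {x. h x \<noteq> 0} x \<partial>lebesgue_on D) = 0" if h: "h \<in> C1_compact D" for h
  proof -
    define \<phi> where "\<phi> k x = real k * (h x)\<^sup>2 / (1 + real k * (h x)\<^sup>2)" for k x
    have \<phi>: "\<phi> k \<in> C1_compact D" for k
      using C1_compact_support_cutoff[OF h, of "real k"] by (simp add: \<phi>_def[abs_def])
    have le1: "\<bar>\<phi> k x\<bar> \<le> 1" for k x
      by (simp add: \<phi>_def abs_mult divide_le_eq add_pos_nonneg)
    have lim: "(\<lambda>k. \<phi> k x) \<longlonglongrightarrow> indicator {x. h x \<noteq> 0} x" for x
    proof (cases "h x = 0")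
      case False
      then have "filterlim (\<lambda>k. (h x)\<^sup>2 * real k) at_top sequentially"
        by (intro filterlim_tendsto_pos_mult_at_top[OF tendsto_const] filterlim_real_sequentially) auto
      then have "filterlim (\<lambda>k. 1 + (h x)\<^sup>2 * real k) at_top sequentially"
        by (rule filterlim_tendsto_add_at_top[OF tendsto_const])
      then have "(\<lambda>k. 1 - inverse (1 + (h x)\<^sup>2 * real k)) \<longlonglongrightarrow> 1 - 0"
        by (intro tendsto_diff tendsto_const tendsto_inverse_0_at_top)
      moreover have "1 - inverse (1 + (h x)\<^sup>2 * real k) = \<phi> k x" for k
      proof -
        have "1 + (h x)\<^sup>2 * real k > 0" by (simp add: add_pos_nonneg)
        then show ?thesis by (simp add: \<phi>_def field_simps)
      qed
      ultimately show ?thesis using False by simp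
    qed (simp add: \<phi>_def)
    have "(\<lambda>k. \<integral>x. g x * \<phi> k x \<partial>lebesgue_on D) \<longlonglongrightarrow> (\<integral>x. g x * indicator {x. h x \<noteq> 0} x \<partial>lebesgue_on D)"
    proof (rule integral_dominated_convergence[where w = "\<lambda>x. \<bar>g x\<bar>"])
      have "{x \<in> space (lebesgue_on D). h x \<noteq> 0} \<in> sets (lebesgue_on D)"
        using C1_compact_measurable_lebesgue_on[OF h, of D] by measurable
      then have "(indicator {x \<in> space (lebesgue_on D). h x \<noteq> 0} :: _ \<Rightarrow> real) \<in> borel_measurable (lebesgue_on D)"
        by (rule borel_measurable_indicator)
      then have "(indicator {x. h x \<noteq> 0} :: _ \<Rightarrow> real) \<in> borel_measurable (lebesgue_on D)"
        by (rule measurable_cong[THEN iffD1, rotated]) (auto simp: indicator_def)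
      then show "(\<lambda>x. g x * indicator {x. h x \<noteq> 0} x) \<in> borel_measurable (lebesgue_on D)"
        using g by (intro borel_measurable_times) auto
      show "(\<lambda>x. g x * \<phi> k x) \<in> borel_measurable (lebesgue_on D)" for k
        using g C1_compact_measurable_lebesgue_on[OF \<phi>] by (intro borel_measurable_times) auto
      show "AE x in lebesgue_on D. norm (g x * \<phi> k x) \<le> \<bar>g x\<bar>" for k
        using le1 by (simp add: abs_mult mult_left_le)
      show "AE x in lebesgue_on D. (\<lambda>k. g x * \<phi> k x) \<longlonglongrightarrow> g x * indicator {x. h x \<noteq> 0} x"
        using lim by (intro AE_I2 tendsto_mult) auto
    qed (use g in simp)
    then show ?thesis using orth[OF \<phi>] by (simp add: LIMSEQ_const_iff)
  qed
  have box0: "(\<integral>x. indicator (box a b) x * g x \<partial>lebesgue_on D) = 0" if cb: "cbox a b \<subseteq> D" for a b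
  proof -
    obtain h where h: "h \<in> C1_compact D" "{x. h x \<noteq> 0} = box a b"
      by (rule box_bump_exists[OF cb])
    have "(\<integral>x. g x * indicator (box a b) x \<partial>lebesgue_on D) = 0"
      using support[OF h(1)] by (simp only: h(2))
    then show ?thesis by (simp only: mult.commute)
  qed
  \<comment> \<open>Restricting \<open>g\<close> to a box inside \<open>D\<close> makes its integrals over all boxes of the plane vanish.\<close>
  have ae_cbox: "AE x in lebesgue. x \<in> cbox a b \<longrightarrow> g x = 0" if ab: "cbox a b \<subseteq> D" for a b
  proof -
    have boxD: "box a b \<subseteq> D" using ab box_subset_cbox by blast
    define f where "f x = indicator (box a b) x * g x" for x
    have f_restrict: "f x = indicator D x *\<^sub>R (indicator (box a b) x * g x)" for x
      using boxD by (auto simp: f_def indicator_def)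
    have "integrable (lebesgue_on D) (\<lambda>x. indicator (box a b) x *\<^sub>R g x)"
      using g boxD by (intro integrable_mult_indicator) (auto simp: sets_restrict_space_iff Dm)
    then have fint: "integrable lebesgue f"
      using Dm by (subst (asm) integrable_restrict_space) (auto simp: f_restrict[abs_def])
    then obtain f' where f': "f' \<in> borel_measurable lborel" "AE x in lborel. f x = f' x"
      using completion_ex_borel_measurable_real[of f lborel] by auto
    have f'm: "f' \<in> borel_measurable lebesgue" using f'(1) by (rule measurable_completion)
    have ae: "AE x in lebesgue. f x = f' x" using f'(2) by (rule AE_completion)
    have int': "integrable lborel f'"
      using fint f' f'm ae integrable_cong_AE[of f lebesgue f'] by (simp add: integrable_completion)
    have eq: "(\<integral>x. indicator (box c d) x * f' x \<partial>lborel) = 0" for c d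
    proof -
      have "(\<integral>x. indicator (box c d) x * f' x \<partial>lborel) = (\<integral>x. indicator (box c d) x * f' x \<partial>lebesgue)"
        using f'(1) by (intro integral_completion[symmetric] borel_measurable_times borel_measurable_indicator) auto
      also have "\<dots> = (\<integral>x. indicator (box c d) x * f x \<partial>lebesgue)"
        using ae fint f'm by (intro integral_cong_AE borel_measurable_times borel_measurable_indicator) auto
      also have "\<dots> = (\<integral>x. indicator D x *\<^sub>R (indicator (box c d \<inter> box a b) x * g x) \<partial>lebesgue)"
        using boxD by (intro Bochner_Integration.integral_cong) (auto simp: f_def indicator_def)
      also have "\<dots> = (\<integral>x. indicator (box c d \<inter> box a b) x * g x \<partial>lebesgue_on D)"
        using Dm by (intro integral_restrict_space[symmetric]) auto
      also have "\<dots> = 0"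
      proof -
        obtain p q where pq: "box c d \<inter> box a b = box p q" using box_Int_box by blast
        show ?thesis
        proof (cases "box p q = {}")
          case False
          have "cbox p q = closure (box p q)" using False by simp
          also have "\<dots> \<subseteq> closure (box a b)" using pq by (intro closure_mono) auto
          also have "\<dots> \<subseteq> cbox a b"
            by (simp add: closure_minimal box_subset_cbox closed_cbox)
          finally show ?thesis using box0[of p q] ab pq by auto
        qed (simp add: pq)
      qed
      finally show ?thesis .
    qed
    have "(\<integral>x. f' x \<partial>lborel) = (\<integral>x. f' x \<partial>lebesgue)"
      using f'(1) by (intro integral_completion[symmetric])
    also have "\<dots> = (\<integral>x. f x \<partial>lebesgue)"
      using ae fint f'm by (intro integral_cong_AE) auto
    also have "\<dots> = (\<integral>x. indicator D x *\<^sub>R (indicator (box a b) x * g x) \<partial>lebesgue)"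
      by (simp add: f_restrict)
    also have "\<dots> = (\<integral>x. indicator (box a b) x * g x \<partial>lebesgue_on D)"
      using Dm by (intro integral_restrict_space[symmetric]) auto
    finally have "(\<integral>x. f' x \<partial>lborel) = 0" using box0[OF ab] by simp
    then have "AE x in lborel. f' x = 0"
      by (intro AE_zero_if_box_integrals_zero int' eq)
    then have "AE x in lebesgue. f' x = 0" by (rule AE_completion)
    moreover have "AE x in lebesgue. x \<notin> cbox a b - box a b"
      using negligible_frontier_interval by (intro AE_not_in) (simp add: negligible_iff_null_sets)
    ultimately show ?thesis
      using ae by eventually_elim (auto simp: f_def indicator_def split: if_splits)
  qed
  obtain \<B> where \<B>: "countable \<B>" "\<B> \<subseteq> Pow D" "\<And>X. X \<in> \<B> \<Longrightarrow> \<exists>a b. X = cbox a b" "\<Union>\<B> = D"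
    by (rule open_countable_Union_open_cbox[OF D]) (rule that)
  have "AE x in lebesgue. \<forall>X\<in>\<B>. x \<in> X \<longrightarrow> g x = 0"
    unfolding AE_ball_countable[OF \<B>(1)]
  proof
    fix X assume "X \<in> \<B>"
    then obtain a b where "X = cbox a b" "X \<subseteq> D" using \<B>(2,3) by (meson PowD subsetD)
    then show "AE x in lebesgue. x \<in> X \<longrightarrow> g x = 0" using ae_cbox[of a b] by simp
  qed
  then have "AE x in lebesgue. x \<in> D \<longrightarrow> g x = 0"
    by eventually_elim (simp only: flip: \<B>(4), blast)
  then show ?thesis using Dm by (simp add: AE_restrict_space_iff)
qed

section \<open>Square integrable functions and weak gradients on bounded open sets\<close>

lemma l2_norm_sq: "(l2_norm D v)\<^sup>2 = l2_inner D v v"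
  by (simp add: l2_norm_def l2_inner_def)

lemma l2_inner_commute: "l2_inner D v w = l2_inner D w v"
  by (simp add: l2_inner_def inner_commute)

lemma l2_inner_self_nonneg: "l2_inner D v v \<ge> 0"
  by (simp add: l2_inner_def)

locale bounded_open_set =
  fixes D :: "(real^2) set"
  assumes open_D: "open D" and bounded_D: "bounded D"
begin

lemma D_sets: "D \<in> sets lebesgue"
  using open_D by auto

lemma finite_measure_D: "finite_measure (lebesgue_on D)"
  using open_D bounded_D by (intro finite_measure_lebesgue_on lmeasurable_open) auto

lemma L2_measurable: "v \<in> L2_space D \<Longrightarrow> v \<in> borel_measurable (lebesgue_on D)"
  by (simp add: L2_space_def)

lemma L2_integrable_inner:
  fixes v w :: "real^2 \<Rightarrow> 'b::euclidean_space"
  assumes "v \<in> L2_space D" "w \<in> L2_space D"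
  shows "integrable (lebesgue_on D) (\<lambda>x. v x \<bullet> w x)"
proof (rule Bochner_Integration.integrable_bound)
  show "integrable (lebesgue_on D) (\<lambda>x. (norm (v x))\<^sup>2 + (norm (w x))\<^sup>2)"
    using assms by (simp add: L2_space_def)
  show "(\<lambda>x. v x \<bullet> w x) \<in> borel_measurable (lebesgue_on D)"
    using assms by (intro borel_measurable_inner L2_measurable)
  have "\<bar>v x \<bullet> w x\<bar> \<le> (norm (v x))\<^sup>2 + (norm (w x))\<^sup>2" for x
  proof -
    have "\<bar>v x \<bullet> w x\<bar> \<le> norm (v x) * norm (w x)" by (rule Cauchy_Schwarz_ineq2)
    also have "\<dots> \<le> (norm (v x))\<^sup>2 + (norm (w x))\<^sup>2"
      using sum_squares_bound[of "norm (v x)" "norm (w x)"]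
        mult_nonneg_nonneg[OF norm_ge_zero[of "v x"] norm_ge_zero[of "w x"]]
      unfolding mult.assoc by linarith
    finally show ?thesis .
  qed
  then show "AE x in lebesgue_on D. norm (v x \<bullet> w x) \<le> norm ((norm (v x))\<^sup>2 + (norm (w x))\<^sup>2)"
    by (intro AE_I2) (simp add: order_trans[OF _ abs_ge_self])
qed

lemma L2I:
  assumes "v \<in> borel_measurable (lebesgue_on D)" "integrable (lebesgue_on D) (\<lambda>x. v x \<bullet> v x)"
  shows "v \<in> L2_space D"
  using assms by (simp add: L2_space_def power2_norm_eq_inner)

lemma L2_lincomb:
  assumes v: "v \<in> L2_space D" and w: "w \<in> L2_space D"
  shows "(\<lambda>x. a *\<^sub>R v x + b *\<^sub>R w x) \<in> L2_space D"
proof (rule L2I)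
  show "(\<lambda>x. a *\<^sub>R v x + b *\<^sub>R w x) \<in> borel_measurable (lebesgue_on D)"
    by (intro borel_measurable_add borel_measurable_scaleR borel_measurable_const L2_measurable v w)
  have "integrable (lebesgue_on D) (\<lambda>x. a\<^sup>2 * (v x \<bullet> v x) + 2 * a * b * (v x \<bullet> w x) + b\<^sup>2 * (w x \<bullet> w x))"
    using assms by (intro Bochner_Integration.integrable_add integrable_mult_right L2_integrable_inner)
  then show "integrable (lebesgue_on D) (\<lambda>x. (a *\<^sub>R v x + b *\<^sub>R w x) \<bullet> (a *\<^sub>R v x + b *\<^sub>R w x))"
    by (rule Bochner_Integration.integrable_cong[OF refl, THEN iffD1, rotated])
       (simp add: inner_add_left inner_add_right inner_commute power2_eq_square algebra_simps)
qed

lemma L2_bounded: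
  assumes "v \<in> borel_measurable (lebesgue_on D)" "\<And>x. x \<in> D \<Longrightarrow> norm (v x) \<le> B"
  shows "v \<in> L2_space D"
proof -
  have "integrable (lebesgue_on D) (\<lambda>x. (norm (v x))\<^sup>2)"
    using assms
    by (intro finite_measure.integrable_const_bound[OF finite_measure_D, of _ "B\<^sup>2"])
       (auto intro!: AE_I2 power_mono)
  then show ?thesis using assms by (simp add: L2_space_def)
qed

lemma L2_continuous:
  fixes v :: "real^2 \<Rightarrow> 'b::euclidean_space"
  assumes "continuous_on (closure D) v"
  shows "v \<in> L2_space D"
proof -
  have "compact (closure D)" using bounded_D by (simp add: compact_closure)
  then have "bounded (v ` closure D)" using assms by (intro compact_imp_bounded compact_continuous_image)
  then obtain B where "\<And>x. x \<in> closure D \<Longrightarrow> norm (v x) \<le> B"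
    by (auto simp: bounded_iff)
  moreover have "v \<in> borel_measurable (lebesgue_on D)"
    using D_sets assms closure_subset
    by (intro continuous_imp_measurable_on_sets_lebesgue continuous_on_subset[OF assms]) auto
  ultimately show ?thesis using closure_subset by (intro L2_bounded[of v B]) auto
qed

lemma L2_inner_const:
  fixes v :: "real^2 \<Rightarrow> 'b::euclidean_space"
  assumes "v \<in> L2_space D" shows "(\<lambda>x. v x \<bullet> c) \<in> L2_space D"
proof (rule L2I)
  show m: "(\<lambda>x. v x \<bullet> c) \<in> borel_measurable (lebesgue_on D)"
    by (intro borel_measurable_inner borel_measurable_const L2_measurable assms)
  have "integrable (lebesgue_on D) (\<lambda>x. (v x \<bullet> v x) * (c \<bullet> c))"
    using assms L2_integrable_inner by auto
  then show "integrable (lebesgue_on D) (\<lambda>x. (v x \<bullet> c) \<bullet> (v x \<bullet> c))"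
  proof (rule Bochner_Integration.integrable_bound)
    show "AE x in lebesgue_on D. norm ((v x \<bullet> c) \<bullet> (v x \<bullet> c)) \<le> norm ((v x \<bullet> v x) * (c \<bullet> c))"
      using Cauchy_Schwarz_ineq by (intro AE_I2) (simp add: power2_eq_square)
  qed (use m in simp)
qed

lemma L2_vec_component: "v \<in> L2_space D \<Longrightarrow> (\<lambda>x. v x $ i) \<in> L2_space D" for v :: "real^2 \<Rightarrow> real^2"
  using L2_inner_const[of v "axis i 1"] by (simp add: inner_axis)

lemma L2_mat_component: "G \<in> L2_space D \<Longrightarrow> (\<lambda>x. G x $ i $ j) \<in> L2_space D" for G :: "real^2 \<Rightarrow> real^2^2"
  using L2_inner_const[of G "axis i (axis j 1)"] by (simp add: inner_axis)

lemma L2_integrable: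
  assumes "v \<in> L2_space D" shows "integrable (lebesgue_on D) (v :: real^2 \<Rightarrow> real)"
proof -
  have "(\<lambda>x. 1::real) \<in> L2_space D" by (intro L2_continuous continuous_intros)
  from L2_integrable_inner[OF assms this] show ?thesis by simp
qed

lemma L2_integrable_mult:
  assumes "v \<in> L2_space D" "w \<in> L2_space D"
  shows "integrable (lebesgue_on D) (\<lambda>x. v x * w x :: real)"
  using L2_integrable_inner[OF assms] by simp

lemma l2_inner_lincomb:
  fixes u :: "real^2 \<Rightarrow> 'b::euclidean_space"
  assumes "u \<in> L2_space D" "v \<in> L2_space D" "w \<in> L2_space D"
  shows "l2_inner D (\<lambda>x. a *\<^sub>R u x + b *\<^sub>R v x) w = a * l2_inner D u w + b * l2_inner D v w"
  using L2_integrable_inner[OF assms(1,3)] L2_integrable_inner[OF assms(2,3)]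
  by (simp add: l2_inner_def inner_add_left)

lemma l2_inner_cong_AE:
  fixes u :: "real^2 \<Rightarrow> 'b::euclidean_space"
  assumes "u \<in> L2_space D" "v \<in> L2_space D" "w \<in> L2_space D" "AE x in lebesgue_on D. u x = v x"
  shows "l2_inner D u w = l2_inner D v w"
  unfolding l2_inner_def using assms
  by (intro integral_cong_AE borel_measurable_inner L2_measurable) auto

lemma l2_inner_self_cong_AE:
  fixes u :: "real^2 \<Rightarrow> 'b::euclidean_space"
  assumes "u \<in> L2_space D" "v \<in> L2_space D" "AE x in lebesgue_on D. u x = v x"
  shows "l2_inner D u u = l2_inner D v v"
  unfolding l2_inner_def using assms
  by (intro integral_cong_AE borel_measurable_inner L2_measurable) auto

text \<open>This bound by squares replaces the triangle inequality of the \<open>L\<^sup>2\<close> norm in the limit arguments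
  below.\<close>

lemma l2_inner_lincomb_self_le:
  fixes u :: "real^2 \<Rightarrow> 'b::euclidean_space"
  assumes "u \<in> L2_space D" "v \<in> L2_space D"
  shows "l2_inner D (\<lambda>x. a *\<^sub>R u x + b *\<^sub>R v x) (\<lambda>x. a *\<^sub>R u x + b *\<^sub>R v x)
    \<le> 2 * a\<^sup>2 * l2_inner D u u + 2 * b\<^sup>2 * l2_inner D v v"
proof -
  have "(a *\<^sub>R p + b *\<^sub>R q) \<bullet> (a *\<^sub>R p + b *\<^sub>R q) \<le> 2 * a\<^sup>2 * (p \<bullet> p) + 2 * b\<^sup>2 * (q \<bullet> q)" for p q :: 'b
    using inner_ge_zero[of "a *\<^sub>R p - b *\<^sub>R q"]
    by (simp add: inner_add_left inner_add_right inner_diff_left inner_diff_right inner_commute power2_eq_square algebra_simps)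
  then have "l2_inner D (\<lambda>x. a *\<^sub>R u x + b *\<^sub>R v x) (\<lambda>x. a *\<^sub>R u x + b *\<^sub>R v x)
    \<le> (\<integral>x. 2 * a\<^sup>2 * (u x \<bullet> u x) + 2 * b\<^sup>2 * (v x \<bullet> v x) \<partial>lebesgue_on D)"
    unfolding l2_inner_def using assms
    by (intro integral_mono L2_integrable_inner L2_lincomb Bochner_Integration.integrable_add integrable_mult_right) auto
  also have "\<dots> = 2 * a\<^sup>2 * l2_inner D u u + 2 * b\<^sup>2 * l2_inner D v v"
    using L2_integrable_inner[OF assms(1) assms(1)] L2_integrable_inner[OF assms(2) assms(2)]
    by (simp add: l2_inner_def)
  finally show ?thesis .
qed

lemma L2_C1_fun: "C1_fun \<phi> \<Longrightarrow> \<phi> \<in> L2_space D"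
  by (intro L2_continuous C1_fun_continuous)

lemma L2_grad: "C1_fun \<phi> \<Longrightarrow> (\<lambda>x. grad \<phi> x $ j) \<in> L2_space D"
  by (intro L2_continuous continuous_on_component) (auto simp: C1_fun_def intro: continuous_on_subset)

lemma has_weak_grad_iff:
  "has_weak_grad D v G \<longleftrightarrow>
     (\<forall>\<phi>\<in>C1_compact D. \<forall>i j. (\<integral>x. v x $ i * grad \<phi> x $ j \<partial>lebesgue_on D)
        = - (\<integral>x. G x $ i $ j * \<phi> x \<partial>lebesgue_on D))"
  by (simp add: has_weak_grad_def grad_def)

lemma has_weak_grad_lincomb:
  assumes L2: "u \<in> L2_space D" "v \<in> L2_space D" "F \<in> L2_space D" "G \<in> L2_space D"
    and "has_weak_grad D u F" "has_weak_grad D v G"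
  shows "has_weak_grad D (\<lambda>x. a *\<^sub>R u x + b *\<^sub>R v x) (\<lambda>x. a *\<^sub>R F x + b *\<^sub>R G x)"
  unfolding has_weak_grad_iff
proof (intro ballI allI)
  fix \<phi> i j assume \<phi>: "\<phi> \<in> C1_compact D"
  then have C1: "C1_fun \<phi>" by (simp add: C1_compact_iff)
  note int = L2_integrable_mult[OF L2_vec_component[OF L2(1)] L2_grad[OF C1], of i j]
    L2_integrable_mult[OF L2_vec_component[OF L2(2)] L2_grad[OF C1], of i j]
    L2_integrable_mult[OF L2_mat_component[OF L2(3)] L2_C1_fun[OF C1], of i j]
    L2_integrable_mult[OF L2_mat_component[OF L2(4)] L2_C1_fun[OF C1], of i j]
  have "(\<integral>x. (a *\<^sub>R u x + b *\<^sub>R v x) $ i * grad \<phi> x $ j \<partial>lebesgue_on D)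
      = a * (\<integral>x. u x $ i * grad \<phi> x $ j \<partial>lebesgue_on D) + b * (\<integral>x. v x $ i * grad \<phi> x $ j \<partial>lebesgue_on D)"
    using int by (simp add: distrib_right mult.assoc)
  also have "\<dots> = - (a * (\<integral>x. F x $ i $ j * \<phi> x \<partial>lebesgue_on D) + b * (\<integral>x. G x $ i $ j * \<phi> x \<partial>lebesgue_on D))"
    using assms(5,6) \<phi> by (simp add: has_weak_grad_iff)
  also have "\<dots> = - (\<integral>x. (a *\<^sub>R F x + b *\<^sub>R G x) $ i $ j * \<phi> x \<partial>lebesgue_on D)"
    using int by (simp add: distrib_right mult.assoc)
  finally show "(\<integral>x. (a *\<^sub>R u x + b *\<^sub>R v x) $ i * grad \<phi> x $ j \<partial>lebesgue_on D)
      = - (\<integral>x. (a *\<^sub>R F x + b *\<^sub>R G x) $ i $ j * \<phi> x \<partial>lebesgue_on D)" .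
qed

lemma has_weak_grad_unique:
  assumes L2: "F \<in> L2_space D" "G \<in> L2_space D"
    and "has_weak_grad D v F" "has_weak_grad D v G"
  shows "AE x in lebesgue_on D. F x = G x"
proof -
  have "AE x in lebesgue_on D. F x $ i $ j - G x $ i $ j = 0" for i j
  proof (rule AE_zero_if_orthogonal_to_C1_compact[OF open_D])
    show "integrable (lebesgue_on D) (\<lambda>x. F x $ i $ j - G x $ i $ j)"
      using L2 by (intro Bochner_Integration.integrable_diff L2_integrable L2_mat_component)
    fix \<phi> assume \<phi>: "\<phi> \<in> C1_compact D"
    then have C1: "C1_fun \<phi>" by (simp add: C1_compact_iff)
    have "(\<integral>x. F x $ i $ j * \<phi> x \<partial>lebesgue_on D) = (\<integral>x. G x $ i $ j * \<phi> x \<partial>lebesgue_on D)"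
      using assms(3)[unfolded has_weak_grad_iff, rule_format, OF \<phi>, of i j]
        assms(4)[unfolded has_weak_grad_iff, rule_format, OF \<phi>, of i j] by linarith
    then show "(\<integral>x. (F x $ i $ j - G x $ i $ j) * \<phi> x \<partial>lebesgue_on D) = 0"
      using L2_integrable_mult[OF L2_mat_component[OF L2(1)] L2_C1_fun[OF C1], of i j]
        L2_integrable_mult[OF L2_mat_component[OF L2(2)] L2_C1_fun[OF C1], of i j]
      by (simp add: left_diff_distrib)
  qed
  then have "AE x in lebesgue_on D. \<forall>i\<in>UNIV. \<forall>j\<in>UNIV. F x $ i $ j - G x $ i $ j = 0"
    by (intro AE_ball_countable[THEN iffD2] ballI) auto
  then show ?thesis by eventually_elim (simp add: vec_eq_iff)
qed

lemma wgrad: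
  assumes "v \<in> H1_space D"
  shows "wgrad D v \<in> L2_space D" "has_weak_grad D v (wgrad D v)"
  using assms someI_ex[of "\<lambda>G. G \<in> L2_space D \<and> has_weak_grad D v G"]
  by (auto simp: H1_space_def wgrad_def)

lemma H1_imp_L2: "v \<in> H1_space D \<Longrightarrow> v \<in> L2_space D"
  by (simp add: H1_space_def)

lemma H1_lincomb:
  assumes "u \<in> H1_space D" "v \<in> H1_space D"
  shows "(\<lambda>x. a *\<^sub>R u x + b *\<^sub>R v x) \<in> H1_space D"
  using has_weak_grad_lincomb[OF H1_imp_L2 H1_imp_L2 wgrad(1) wgrad(1) wgrad(2) wgrad(2)] assms
  by (simp (no_asm) only: H1_space_def mem_Collect_eq) (blast intro: L2_lincomb H1_imp_L2 wgrad(1))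

lemma wgrad_AE_eqI:
  assumes "v \<in> L2_space D" "G \<in> L2_space D" "has_weak_grad D v G"
  shows "v \<in> H1_space D" "AE x in lebesgue_on D. wgrad D v x = G x"
proof -
  show H1: "v \<in> H1_space D" using assms by (auto simp: H1_space_def)
  show "AE x in lebesgue_on D. wgrad D v x = G x"
    using wgrad[OF H1] assms by (intro has_weak_grad_unique)
qed

lemma wgrad_lincomb:
  assumes "u \<in> H1_space D" "v \<in> H1_space D"
  shows "AE x in lebesgue_on D. wgrad D (\<lambda>x. a *\<^sub>R u x + b *\<^sub>R v x) x = a *\<^sub>R wgrad D u x + b *\<^sub>R wgrad D v x"
  using assms wgrad by (intro wgrad_AE_eqI(2) L2_lincomb H1_imp_L2 has_weak_grad_lincomb)

lemma l2_inner_wgrad_lincomb: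
  assumes "u \<in> H1_space D" "v \<in> H1_space D" "G \<in> L2_space D"
  shows "l2_inner D (wgrad D (\<lambda>x. a *\<^sub>R u x + b *\<^sub>R v x)) G
    = a * l2_inner D (wgrad D u) G + b * l2_inner D (wgrad D v) G"
  using l2_inner_cong_AE[OF wgrad(1)[OF H1_lincomb] _ assms(3) wgrad_lincomb] assms
  by (simp add: L2_lincomb wgrad l2_inner_lincomb)

lemma wdiv_L2: "v \<in> H1_space D \<Longrightarrow> wdiv D v \<in> L2_space D"
  using L2_lincomb[OF L2_mat_component[OF wgrad(1), of v 1 1] L2_mat_component[OF wgrad(1), of v 2 2], of 1 1]
  by (simp add: wdiv_def[abs_def] sum_2)

lemma l2_inner_wdiv_lincomb:
  assumes "u \<in> H1_space D" "v \<in> H1_space D" "q \<in> L2_space D"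
  shows "l2_inner D (wdiv D (\<lambda>x. a *\<^sub>R u x + b *\<^sub>R v x)) q
    = a * l2_inner D (wdiv D u) q + b * l2_inner D (wdiv D v) q"
proof -
  have "AE x in lebesgue_on D. wdiv D (\<lambda>x. a *\<^sub>R u x + b *\<^sub>R v x) x = a *\<^sub>R wdiv D u x + b *\<^sub>R wdiv D v x"
    using wgrad_lincomb[OF assms(1,2), of a b]
    by eventually_elim (simp add: wdiv_def sum_2 algebra_simps)
  then have "l2_inner D (wdiv D (\<lambda>x. a *\<^sub>R u x + b *\<^sub>R v x)) q = l2_inner D (\<lambda>x. a *\<^sub>R wdiv D u x + b *\<^sub>R wdiv D v x) q"
    using assms by (intro l2_inner_cong_AE wdiv_L2 H1_lincomb L2_lincomb)
  then show ?thesis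
    using l2_inner_lincomb[OF wdiv_L2[OF assms(1)] wdiv_L2[OF assms(2)] assms(3)] by simp
qed

end

section \<open>Linearity and the Poincare inequality on the velocity space\<close>

lemma integral_grad_on_eq_0:
  assumes "open D" "\<phi> \<in> C1_compact D"
  shows "(\<integral>x. grad \<phi> x $ j \<partial>lebesgue_on D) = 0"
proof -
  have "continuous_on UNIV (\<lambda>x. grad \<phi> x $ j)"
    using assms(2) by (intro continuous_on_component) (auto simp: C1_compact_iff C1_fun_def)
  moreover have "grad \<phi> x $ j = 0" if "x \<notin> D" for x
  proof -
    have "x \<notin> closure {x. \<phi> x \<noteq> 0}" using that assms(2) unfolding C1_compact_iff by blast
    then show ?thesis by (simp add: grad_eq_0_outside_support)
  qed
  ultimately have "(\<integral>x. grad \<phi> x $ j \<partial>lebesgue_on D) = (\<integral>x. grad \<phi> x $ j \<partial>lborel)"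
    using assms(1) by (intro integral_lebesgue_on_borel borel_measurable_continuous_onI) auto
  then show ?thesis using integral_grad_eq_0[OF assms(2)] by simp
qed

lemma h1_norm_sq: "(h1_norm D v)\<^sup>2 = l2_inner D v v + l2_inner D (wgrad D v) (wgrad D v)"
  by (simp add: h1_norm_def l2_norm_sq l2_inner_self_nonneg)

context bounded_open_set
begin

text \<open>Weak and classical gradients of test functions agree, because the gradient of the product with
  another test function has integral \<open>0\<close>.  In particular the approximants \<open>\<phi> k\<close> in the definition of
  the velocity space have meaningful \<open>H\<^sup>1\<close> norms.\<close>

lemma C1_vector_weak_grad:
  assumes "\<And>i. (\<lambda>x. \<phi> x $ i) \<in> C1_compact D"
  defines "G \<equiv> \<lambda>x. \<chi> i. grad (\<lambda>x. \<phi> x $ i) x"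
  shows "\<phi> \<in> L2_space D" "G \<in> L2_space D" "has_weak_grad D \<phi> G"
proof -
  have C1: "C1_fun (\<lambda>x. \<phi> x $ i)" for i using assms(1) by (simp add: C1_compact_iff)
  have "continuous_on (closure D) (\<lambda>x. \<chi> i. \<phi> x $ i)"
    by (intro continuous_on_vec_lambda C1_fun_continuous C1)
  then show "\<phi> \<in> L2_space D" by (intro L2_continuous) simp
  show "G \<in> L2_space D"
    unfolding G_def using C1
    by (intro L2_continuous continuous_on_vec_lambda) (auto simp: C1_fun_def intro: continuous_on_subset)
  show "has_weak_grad D \<phi> G"
    unfolding has_weak_grad_iff
  proof (intro ballI allI)
    fix \<psi> i j assume \<psi>: "\<psi> \<in> C1_compact D"
    then have C1': "C1_fun \<psi>" by (simp add: C1_compact_iff)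
    have "(\<lambda>x. \<psi> x * \<phi> x $ i) \<in> C1_compact D"
      by (rule C1_compact_subsupport[OF \<psi> C1_fun_mult(1)[OF C1' C1]]) simp
    from integral_grad_on_eq_0[OF open_D this, of j]
    have "(\<integral>x. \<phi> x $ i * grad \<psi> x $ j + grad (\<lambda>x. \<phi> x $ i) x $ j * \<psi> x \<partial>lebesgue_on D) = 0"
      by (simp add: C1_fun_mult(2)[OF C1' C1] mult.commute)
    then show "(\<integral>x. \<phi> x $ i * grad \<psi> x $ j \<partial>lebesgue_on D) = - (\<integral>x. G x $ i $ j * \<psi> x \<partial>lebesgue_on D)"
      using L2_integrable_mult[OF L2_C1_fun[OF C1] L2_grad[OF C1'], of i j]
        L2_integrable_mult[OF L2_grad[OF C1] L2_C1_fun[OF C1'], of i j]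
      by (simp add: G_def)
  qed
qed

lemma C1_vector_H1: "(\<And>i. (\<lambda>x. \<phi> x $ i) \<in> C1_compact D) \<Longrightarrow> \<phi> \<in> H1_space D"
  using C1_vector_weak_grad[of \<phi>] wgrad_AE_eqI(1) by blast

text \<open>Integrating the derivative of \<open>x\<^sub>1 \<phi>\<^sup>2\<close> in direction \<open>1\<close> gives
  \<open>\<integral> \<phi>\<^sup>2 = - 2 \<integral> x\<^sub>1 \<phi> \<partial>\<^sub>1\<phi>\<close>, and Young's inequality absorbs half of the left-hand side.\<close>

lemma poincare_C1_compact:
  assumes R: "\<And>x. x \<in> D \<Longrightarrow> norm x \<le> R" and \<phi>: "\<phi> \<in> C1_compact D"
  shows "(\<integral>x. (\<phi> x)\<^sup>2 \<partial>lebesgue_on D) \<le> 4 * R\<^sup>2 * (\<integral>x. (grad \<phi> x $ 1)\<^sup>2 \<partial>lebesgue_on D)"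
proof -
  have C1: "C1_fun \<phi>" using \<phi> by (simp add: C1_compact_iff)
  note sq = C1_fun_mult[OF C1 C1]
  note prod = C1_fun_mult[OF C1_fun_component(1)[of 1] sq(1)]
  have "(\<lambda>x. x $ 1 * (\<phi> x * \<phi> x)) \<in> C1_compact D"
    by (rule C1_compact_subsupport[OF \<phi> prod(1)]) simp
  from integral_grad_on_eq_0[OF open_D this, of 1]
  have zero: "(\<integral>x. (\<phi> x)\<^sup>2 + 2 * (x $ 1 * \<phi> x * grad \<phi> x $ 1) \<partial>lebesgue_on D) = 0"
    unfolding prod(2) sq(2) C1_fun_component(2) by (simp add: power2_eq_square algebra_simps)
  have int1: "integrable (lebesgue_on D) (\<lambda>x. (\<phi> x)\<^sup>2)"
    using L2_integrable_mult[OF L2_C1_fun[OF C1] L2_C1_fun[OF C1]] by (simp add: power2_eq_square)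
  have int2: "integrable (lebesgue_on D) (\<lambda>x. (grad \<phi> x $ 1)\<^sup>2)"
    using L2_integrable_mult[OF L2_grad[OF C1] L2_grad[OF C1]] by (simp add: power2_eq_square)
  have int3: "integrable (lebesgue_on D) (\<lambda>x. x $ 1 * \<phi> x * grad \<phi> x $ 1)"
    using L2_integrable_mult[OF L2_C1_fun[OF C1_fun_mult(1)[OF C1_fun_component(1)[of 1] C1]] L2_grad[OF C1]] .
  have "1/2 * (\<phi> x)\<^sup>2 - 2 * R\<^sup>2 * (grad \<phi> x $ 1)\<^sup>2 \<le> (\<phi> x)\<^sup>2 + 2 * (x $ 1 * \<phi> x * grad \<phi> x $ 1)"
    if "x \<in> D" for x
  proof -
    have "\<bar>x $ 1\<bar> \<le> R" using R[OF that] component_le_norm_cart[of x 1] by linarith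
    then have "(x $ 1)\<^sup>2 \<le> R\<^sup>2" by (metis abs_le_square_iff abs_of_nonneg abs_ge_zero order_trans)
    then have "(x $ 1)\<^sup>2 * (grad \<phi> x $ 1)\<^sup>2 \<le> R\<^sup>2 * (grad \<phi> x $ 1)\<^sup>2"
      by (rule mult_right_mono) simp
    moreover have "0 \<le> (\<phi> x + 2 * (x $ 1) * grad \<phi> x $ 1)\<^sup>2" by simp
    ultimately show ?thesis by (simp add: power2_eq_square algebra_simps)
  qed
  then have "(\<integral>x. 1/2 * (\<phi> x)\<^sup>2 - 2 * R\<^sup>2 * (grad \<phi> x $ 1)\<^sup>2 \<partial>lebesgue_on D)
      \<le> (\<integral>x. (\<phi> x)\<^sup>2 + 2 * (x $ 1 * \<phi> x * grad \<phi> x $ 1) \<partial>lebesgue_on D)"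
    by (intro integral_mono Bochner_Integration.integrable_diff Bochner_Integration.integrable_add
          integrable_mult_right int1 int2 int3) auto
  then show ?thesis using int1 int2 unfolding zero by simp
qed

lemma poincare_C1_vector:
  assumes R: "\<And>x. x \<in> D \<Longrightarrow> norm x \<le> R" and \<phi>: "\<And>i. (\<lambda>x. \<phi> x $ i) \<in> C1_compact D"
  shows "l2_inner D \<phi> \<phi> \<le> 4 * R\<^sup>2 * l2_inner D (wgrad D \<phi>) (wgrad D \<phi>)"
proof -
  define G :: "real^2 \<Rightarrow> real^2^2" where "G = (\<lambda>x. \<chi> i. grad (\<lambda>x. \<phi> x $ i) x)"
  note G = C1_vector_weak_grad[of \<phi>, OF \<phi>, folded G_def]
  have sq: "integrable (lebesgue_on D) (\<lambda>x. (\<phi> x $ i)\<^sup>2)" "integrable (lebesgue_on D) (\<lambda>x. (G x $ i $ 1)\<^sup>2)" for i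
    using L2_integrable_mult[OF L2_vec_component L2_vec_component, OF G(1) G(1), of i i]
      L2_integrable_mult[OF L2_mat_component L2_mat_component, OF G(2) G(2), of i 1 i 1]
    by (simp_all add: power2_eq_square)
  have "l2_inner D \<phi> \<phi> = (\<Sum>i\<in>UNIV. \<integral>x. (\<phi> x $ i)\<^sup>2 \<partial>lebesgue_on D)"
    unfolding l2_inner_def inner_vec_def using sq(1) by (simp add: power2_eq_square)
  also have "\<dots> \<le> (\<Sum>i\<in>UNIV. 4 * R\<^sup>2 * (\<integral>x. (G x $ i $ 1)\<^sup>2 \<partial>lebesgue_on D))"
    using poincare_C1_compact[OF R \<phi>] by (intro sum_mono) (simp add: G_def)
  also have "\<dots> = 4 * R\<^sup>2 * (\<integral>x. (\<Sum>i\<in>UNIV. (G x $ i $ 1)\<^sup>2) \<partial>lebesgue_on D)"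
    using sq(2) by (simp add: sum_distrib_left)
  also have "\<dots> \<le> 4 * R\<^sup>2 * l2_inner D G G"
    unfolding l2_inner_def
  proof (intro mult_left_mono integral_mono L2_integrable_inner G)
    show "integrable (lebesgue_on D) (\<lambda>x. \<Sum>i\<in>UNIV. (G x $ i $ 1)\<^sup>2)"
      using sq(2) by simp
    show "(\<Sum>i\<in>UNIV. (G x $ i $ 1)\<^sup>2) \<le> G x \<bullet> G x" for x
      by (simp add: inner_vec_def sum_2 power2_eq_square)
  qed simp
  also have "l2_inner D G G = l2_inner D (wgrad D \<phi>) (wgrad D \<phi>)"
    using wgrad(1)[OF C1_vector_H1[OF \<phi>]] G wgrad_AE_eqI(2)[OF G]
    by (intro l2_inner_self_cong_AE[symmetric])
  finally show ?thesis .
qed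

lemma l2_inner_wgrad_lincomb_self_le:
  assumes "u \<in> H1_space D" "v \<in> H1_space D"
  shows "l2_inner D (wgrad D (\<lambda>x. a *\<^sub>R u x + b *\<^sub>R v x)) (wgrad D (\<lambda>x. a *\<^sub>R u x + b *\<^sub>R v x))
    \<le> 2 * a\<^sup>2 * l2_inner D (wgrad D u) (wgrad D u) + 2 * b\<^sup>2 * l2_inner D (wgrad D v) (wgrad D v)"
  using l2_inner_self_cong_AE[OF wgrad(1)[OF H1_lincomb] L2_lincomb wgrad_lincomb, OF assms wgrad(1) wgrad(1) assms]
    l2_inner_lincomb_self_le[OF wgrad(1) wgrad(1), OF assms] assms
  by simp

text \<open>The inequality passes from test functions to their limits in \<open>H\<^sup>1\<close>.  Passing to the approximant and
  back costs a factor \<open>2\<close> each time, which turns \<open>4 R\<^sup>2\<close> into \<open>16 R\<^sup>2\<close>.\<close>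

lemma poincare_X:
  obtains C where "C > 0"
    "\<And>v. v \<in> X_space D \<Longrightarrow> (l2_norm D v)\<^sup>2 \<le> C * (l2_norm D (wgrad D v))\<^sup>2"
proof -
  obtain R where R: "\<And>x. x \<in> D \<Longrightarrow> norm x \<le> R" "R > 0"
    using bounded_D by (metis bounded_pos)
  define C where "C = 16 * R\<^sup>2"
  have "(l2_norm D v)\<^sup>2 \<le> C * (l2_norm D (wgrad D v))\<^sup>2" if v: "v \<in> X_space D" for v
  proof -
    obtain \<phi> :: "nat \<Rightarrow> real^2 \<Rightarrow> real^2" where \<phi>: "\<And>k i. (\<lambda>x. \<phi> k x $ i) \<in> C1_compact D"
      and lim: "(\<lambda>k. h1_norm D (\<lambda>x. \<phi> k x - v x)) \<longlonglongrightarrow> 0"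
      using v by (auto simp: X_space_def)
    have vH1: "v \<in> H1_space D" using v by (simp add: X_space_def)
    define \<delta> where "\<delta> k x = \<phi> k x - v x" for k x
    have \<phi>H1: "\<phi> k \<in> H1_space D" for k by (rule C1_vector_H1[OF \<phi>])
    have \<delta>H1: "\<delta> k \<in> H1_space D" for k
      using H1_lincomb[OF \<phi>H1[of k] vH1, of 1 "-1"] by (simp add: \<delta>_def[abs_def])
    have "l2_inner D v v \<le> C * l2_inner D (wgrad D v) (wgrad D v) + (C + 2) * (h1_norm D (\<delta> k))\<^sup>2" for k
    proof -
      have "l2_inner D v v \<le> 2 * l2_inner D (\<phi> k) (\<phi> k) + 2 * l2_inner D (\<delta> k) (\<delta> k)"
        using l2_inner_lincomb_self_le[OF H1_imp_L2[OF \<phi>H1] H1_imp_L2[OF \<delta>H1], of 1 k "-1" k]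
        by (simp add: \<delta>_def)
      moreover have "l2_inner D (\<phi> k) (\<phi> k) \<le> 4 * R\<^sup>2 * l2_inner D (wgrad D (\<phi> k)) (wgrad D (\<phi> k))"
        by (rule poincare_C1_vector[OF R(1) \<phi>])
      moreover have "4 * R\<^sup>2 * l2_inner D (wgrad D (\<phi> k)) (wgrad D (\<phi> k))
          \<le> 4 * R\<^sup>2 * (2 * l2_inner D (wgrad D v) (wgrad D v) + 2 * l2_inner D (wgrad D (\<delta> k)) (wgrad D (\<delta> k)))"
        using l2_inner_wgrad_lincomb_self_le[OF vH1 \<delta>H1, of 1 1 k]
        by (intro mult_left_mono) (simp_all add: \<delta>_def)
      ultimately have "l2_inner D v v \<le> C * l2_inner D (wgrad D v) (wgrad D v)
          + C * l2_inner D (wgrad D (\<delta> k)) (wgrad D (\<delta> k)) + 2 * l2_inner D (\<delta> k) (\<delta> k)"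
        by (simp add: C_def algebra_simps)
      moreover have "0 \<le> C * l2_inner D (\<delta> k) (\<delta> k) + 2 * l2_inner D (wgrad D (\<delta> k)) (wgrad D (\<delta> k))"
        by (simp add: C_def l2_inner_self_nonneg)
      ultimately show ?thesis by (simp add: h1_norm_sq algebra_simps)
    qed
    moreover have "(\<lambda>k. C * l2_inner D (wgrad D v) (wgrad D v) + (C + 2) * (h1_norm D (\<delta> k))\<^sup>2)
        \<longlonglongrightarrow> C * l2_inner D (wgrad D v) (wgrad D v) + (C + 2) * 0\<^sup>2"
      using lim by (intro tendsto_intros) (simp add: \<delta>_def[abs_def])
    ultimately show ?thesis by (auto intro: LIMSEQ_le_const simp: l2_norm_sq)
  qed
  then show thesis using R(2) by (intro that[of C]) (auto simp: C_def)
qed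

lemma X_lincomb:
  assumes u: "u \<in> X_space D" and v: "v \<in> X_space D"
  shows "(\<lambda>x. a *\<^sub>R u x + b *\<^sub>R v x) \<in> X_space D"
proof -
  obtain \<phi> \<psi> :: "nat \<Rightarrow> real^2 \<Rightarrow> real^2"
    where \<phi>: "\<And>k i. (\<lambda>x. \<phi> k x $ i) \<in> C1_compact D"
      and \<phi>lim: "(\<lambda>k. h1_norm D (\<lambda>x. \<phi> k x - u x)) \<longlonglongrightarrow> 0"
      and \<psi>: "\<And>k i. (\<lambda>x. \<psi> k x $ i) \<in> C1_compact D"
      and \<psi>lim: "(\<lambda>k. h1_norm D (\<lambda>x. \<psi> k x - v x)) \<longlonglongrightarrow> 0"
    using u v by (auto simp: X_space_def)
  have uv: "u \<in> H1_space D" "v \<in> H1_space D" using u v by (auto simp: X_space_def)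
  define d where "d k x = \<phi> k x - u x" for k x
  define e where "e k x = \<psi> k x - v x" for k x
  have H1: "d k \<in> H1_space D" "e k \<in> H1_space D" for k
    using H1_lincomb[OF C1_vector_H1[OF \<phi>[of k]] uv(1), of 1 "-1"]
      H1_lincomb[OF C1_vector_H1[OF \<psi>[of k]] uv(2), of 1 "-1"]
    by (simp_all add: d_def[abs_def] e_def[abs_def])
  have bound: "h1_norm D (\<lambda>x. a *\<^sub>R d k x + b *\<^sub>R e k x)
      \<le> sqrt (2 * a\<^sup>2 * (h1_norm D (d k))\<^sup>2 + 2 * b\<^sup>2 * (h1_norm D (e k))\<^sup>2)" for k
    using l2_inner_lincomb_self_le[OF H1_imp_L2 H1_imp_L2, OF H1, of a k b k]
      l2_inner_wgrad_lincomb_self_le[OF H1, of a k b k]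
    by (intro real_le_rsqrt) (simp add: h1_norm_sq algebra_simps)
  have "(\<lambda>k. h1_norm D (\<lambda>x. a *\<^sub>R d k x + b *\<^sub>R e k x)) \<longlonglongrightarrow> 0"
  proof (rule tendsto_sandwich[OF _ _ tendsto_const])
    have "(\<lambda>k. sqrt (2 * a\<^sup>2 * (h1_norm D (d k))\<^sup>2 + 2 * b\<^sup>2 * (h1_norm D (e k))\<^sup>2))
        \<longlonglongrightarrow> sqrt (2 * a\<^sup>2 * 0\<^sup>2 + 2 * b\<^sup>2 * 0\<^sup>2)"
      using \<phi>lim \<psi>lim by (intro tendsto_intros) (simp_all add: d_def[abs_def] e_def[abs_def])
    then show "(\<lambda>k. sqrt (2 * a\<^sup>2 * (h1_norm D (d k))\<^sup>2 + 2 * b\<^sup>2 * (h1_norm D (e k))\<^sup>2)) \<longlonglongrightarrow> 0"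
      by simp
  qed (use bound in \<open>auto simp: h1_norm_def l2_norm_sq l2_inner_self_nonneg\<close>)
  moreover have "(\<lambda>x. (a *\<^sub>R \<phi> k x + b *\<^sub>R \<psi> k x) $ i) \<in> C1_compact D" for k i
    using C1_compact_lincomb[OF \<phi> \<psi>] by simp
  moreover have "(\<lambda>x. a *\<^sub>R d k x + b *\<^sub>R e k x)
      = (\<lambda>x. (a *\<^sub>R \<phi> k x + b *\<^sub>R \<psi> k x) - (a *\<^sub>R u x + b *\<^sub>R v x))" for k
    by (simp add: d_def e_def algebra_simps)
  ultimately show ?thesis
    using H1_lincomb[OF uv, of a b]
    unfolding X_space_def by (auto intro!: exI[of _ "\<lambda>k x. a *\<^sub>R \<phi> k x + b *\<^sub>R \<psi> k x"])
qed

end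

section \<open>Finite element spaces are closed under linear combinations\<close>

text \<open>A weak form of being a linear subspace, for sets of functions with pointwise operations; it is what
  three-term combinations need.\<close>

definition lincomb_closed :: "(real^2 \<Rightarrow> 'b::real_vector) set \<Rightarrow> bool" where
  "lincomb_closed S \<longleftrightarrow> (\<forall>u\<in>S. \<forall>v\<in>S. \<forall>a b. (\<lambda>x. a *\<^sub>R u x + b *\<^sub>R v x) \<in> S)"

lemma three_point_expand:
  "1 \<le> n \<Longrightarrow> three_point c z n = (\<lambda>x. c 0 *\<^sub>R z (n - 1) x + c 1 *\<^sub>R z n x + c 2 *\<^sub>R z (n + 1) x)"
  by (simp add: three_point_def numeral_2_eq_2 fun_eq_iff)

lemma lincomb_closedD:
  "lincomb_closed S \<Longrightarrow> u \<in> S \<Longrightarrow> v \<in> S \<Longrightarrow> (\<lambda>x. a *\<^sub>R u x + b *\<^sub>R v x) \<in> S"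
  by (simp add: lincomb_closed_def)

lemma three_point_closed:
  assumes S: "lincomb_closed S" and n: "1 \<le> n" and z: "z (n - 1) \<in> S" "z n \<in> S" "z (n + 1) \<in> S"
  shows "three_point c z n \<in> S"
  using lincomb_closedD[OF S lincomb_closedD[OF S z(1,2)] z(3), of 1 "c 0" "c 1" "c 2"]
  by (simp add: three_point_expand[OF n])

text \<open>Only linearity of \<open>L\<close> on \<open>S\<close> is asked for, because the functionals of interest involve weak
  gradients and are linear on \<open>H\<^sup>1\<close> only.\<close>

lemma three_point_linear:
  assumes S: "lincomb_closed S" and n: "1 \<le> n" and z: "z (n - 1) \<in> S" "z n \<in> S" "z (n + 1) \<in> S"
    and lin: "\<And>u v a b. u \<in> S \<Longrightarrow> v \<in> S \<Longrightarrow> L (\<lambda>x. a *\<^sub>R u x + b *\<^sub>R v x) = a * L u + b * (L v :: real)"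
  shows "L (three_point c z n) = c 0 * L (z (n - 1)) + c 1 * L (z n) + c 2 * L (z (n + 1))"
  using lin[OF lincomb_closedD[OF S z(1,2)] z(3), of 1 "c 0" "c 1" "c 2"] lin[OF z(1,2), of "c 0" "c 1"]
  by (simp add: three_point_expand[OF n])

lemma is_poly_lincomb:
  assumes "is_poly d K p" "is_poly d K q"
  shows "is_poly d K (\<lambda>x. a * p x + b * q x)"
proof -
  obtain c c' where
    "\<forall>x\<in>K. p x = (\<Sum>i\<le>d. \<Sum>j\<le>d - i. c i j * (x $ 1) ^ i * (x $ 2) ^ j)"
    "\<forall>x\<in>K. q x = (\<Sum>i\<le>d. \<Sum>j\<le>d - i. c' i j * (x $ 1) ^ i * (x $ 2) ^ j)"
    using assms unfolding is_poly_def by blast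
  then have "\<forall>x\<in>K. a * p x + b * q x
      = (\<Sum>i\<le>d. \<Sum>j\<le>d - i. (a * c i j + b * c' i j) * (x $ 1) ^ i * (x $ 2) ^ j)"
    by (simp add: sum_distrib_left sum.distrib algebra_simps)
  then show ?thesis
    unfolding is_poly_def by (intro exI[of _ "\<lambda>i j. a * c i j + b * c' i j"])
qed

context bounded_open_set
begin

lemma Xh_subset_H1: "Xh_space D r \<K> \<subseteq> H1_space D"
  by (auto simp: Xh_space_def X_space_def)

lemma Vh_subset_Xh: "Vh_space D r \<K> \<subseteq> Xh_space D r \<K>"
  by (auto simp: Vh_space_def)

lemma Qh_subset_L2: "Qh_space D r \<K> \<subseteq> L2_space D"
  by (auto simp: Qh_space_def Q_space_def)

lemma lincomb_closed_L2: "lincomb_closed (L2_space D :: (real^2 \<Rightarrow> 'b::euclidean_space) set)"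
  by (simp add: lincomb_closed_def L2_lincomb)

lemma lincomb_closed_Xh: "lincomb_closed (Xh_space D r \<K>)"
  unfolding lincomb_closed_def
proof (intro ballI allI)
  fix u v a b assume u: "u \<in> Xh_space D r \<K>" and v: "v \<in> Xh_space D r \<K>"
  then show "(\<lambda>x. a *\<^sub>R u x + b *\<^sub>R v x) \<in> Xh_space D r \<K>"
    unfolding Xh_space_def
    using X_lincomb is_poly_lincomb by (auto intro!: continuous_intros)
qed

lemma lincomb_closed_Qh: "lincomb_closed (Qh_space D r \<K>)"
  unfolding lincomb_closed_def
proof (intro ballI allI)
  fix p q :: "real^2 \<Rightarrow> real" and a b
  assume p: "p \<in> Qh_space D r \<K>" and q: "q \<in> Qh_space D r \<K>"
  then have L2: "p \<in> L2_space D" "q \<in> L2_space D" using Qh_subset_L2 by auto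
  have "(\<integral>x. a *\<^sub>R p x + b *\<^sub>R q x \<partial>lebesgue_on D) = 0"
    using p q L2_integrable[OF L2(1)] L2_integrable[OF L2(2)] by (simp add: Qh_space_def Q_space_def)
  then show "(\<lambda>x. a *\<^sub>R p x + b *\<^sub>R q x) \<in> Qh_space D r \<K>"
    using p q L2_lincomb[OF L2, of a b]
    by (auto simp: Qh_space_def Q_space_def intro!: continuous_intros is_poly_lincomb)
qed

text \<open>The discrete divergence constraint is linear because the weak divergence is linear almost everywhere
  on \<open>H\<^sup>1\<close>.\<close>

lemma lincomb_closed_Vh: "lincomb_closed (Vh_space D r \<K>)"
  unfolding lincomb_closed_def
proof (intro ballI allI)
  fix u v a b assume u: "u \<in> Vh_space D r \<K>" and v: "v \<in> Vh_space D r \<K>"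
  have H1: "u \<in> H1_space D" "v \<in> H1_space D"
    using u v Vh_subset_Xh Xh_subset_H1 by blast+
  have "l2_inner D (wdiv D (\<lambda>x. a *\<^sub>R u x + b *\<^sub>R v x)) q = 0" if "q \<in> Qh_space D r \<K>" for q
    using l2_inner_wdiv_lincomb[OF H1, of q a b] that Qh_subset_L2 u v by (auto simp: Vh_space_def)
  then show "(\<lambda>x. a *\<^sub>R u x + b *\<^sub>R v x) \<in> Vh_space D r \<K>"
    using lincomb_closed_Xh u v unfolding Vh_space_def lincomb_closed_def by simp
qed

end

section \<open>Algebra of the DLN coefficients\<close>

lemma dln_denominator_pos:
  fixes e \<theta> :: real
  assumes "\<bar>e\<bar> < 1" "0 \<le> \<theta>" "\<theta> \<le> 1"
  shows "1 + e * \<theta> > 0"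
proof -
  have "\<bar>e * \<theta>\<bar> \<le> \<bar>e\<bar> * 1" unfolding abs_mult using assms by (intro mult_left_mono) auto
  then show ?thesis using assms(1) by linarith
qed

lemma inner_three_term_combinations:
  fixes x0 x1 x2 :: "'a::real_inner"
  shows "(a0 *\<^sub>R x0 + a1 *\<^sub>R x1 + a2 *\<^sub>R x2) \<bullet> (b0 *\<^sub>R x0 + b1 *\<^sub>R x1 + b2 *\<^sub>R x2)
    = a0 * b0 * (x0 \<bullet> x0) + a1 * b1 * (x1 \<bullet> x1) + a2 * b2 * (x2 \<bullet> x2)
      + (a0 * b1 + a1 * b0) * (x0 \<bullet> x1) + (a0 * b2 + a2 * b0) * (x0 \<bullet> x2)
      + (a1 * b2 + a2 * b1) * (x1 \<bullet> x2)"
  by (simp add: inner_add_left inner_add_right inner_commute[of x1 x0] inner_commute[of x2 x0]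
        inner_commute[of x2 x1] algebra_simps)

text \<open>The G-stability identity of the DLN method.  Both sides are quadratic forms in \<open>(x0, x1, x2)\<close>; their six
  coefficients agree because of \<open>1 - \<theta>\<^sup>2 = y (1 + e \<theta>)\<^sup>2\<close> and \<open>s\<^sup>2 = \<theta> y / 2\<close> for the numbers \<open>y\<close> and
  \<open>s\<close> introduced in the proof.\<close>

lemma dln_G_identity:
  fixes x0 x1 x2 :: "'a::real_inner"
  assumes "\<bar>e\<bar> < 1" "0 \<le> \<theta>" "\<theta> \<le> 1"
  shows "(dln_alpha \<theta> 0 *\<^sub>R x0 + dln_alpha \<theta> 1 *\<^sub>R x1 + dln_alpha \<theta> 2 *\<^sub>R x2)
       \<bullet> (dln_beta \<theta> e 0 *\<^sub>R x0 + dln_beta \<theta> e 1 *\<^sub>R x1 + dln_beta \<theta> e 2 *\<^sub>R x2)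
     = ((1 + \<theta>) / 4 * (x2 \<bullet> x2) + (1 - \<theta>) / 4 * (x1 \<bullet> x1))
       - ((1 + \<theta>) / 4 * (x1 \<bullet> x1) + (1 - \<theta>) / 4 * (x0 \<bullet> x0))
       + (dln_a \<theta> e 0 *\<^sub>R x0 + dln_a \<theta> e 1 *\<^sub>R x1 + dln_a \<theta> e 2 *\<^sub>R x2)
         \<bullet> (dln_a \<theta> e 0 *\<^sub>R x0 + dln_a \<theta> e 1 *\<^sub>R x1 + dln_a \<theta> e 2 *\<^sub>R x2)"
proof -
  define y where "y = (1 - \<theta>\<^sup>2) / (1 + e * \<theta>)\<^sup>2"
  define s where "s = dln_a1 \<theta> e"
  have pos: "1 + e * \<theta> > 0" by (rule dln_denominator_pos[OF assms])
  then have y: "1 - \<theta>\<^sup>2 = y * (1 + e * \<theta>)\<^sup>2" by (simp add: y_def)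
  have "\<theta>\<^sup>2 \<le> 1" using assms by (simp add: power_le_one)
  then have s2: "s * s = \<theta> * y / 2"
    using assms(2) by (simp add: s_def dln_a1_def y_def power2_eq_square[symmetric] power_divide power_mult_distrib)
  have beta: "dln_beta \<theta> e 0 = 1/4 * (1 + y - e\<^sup>2 * (\<theta> * y) - \<theta>)"
    "dln_beta \<theta> e 1 = 1/2 * (1 - y)"
    "dln_beta \<theta> e 2 = 1/4 * (1 + y + e\<^sup>2 * (\<theta> * y) + \<theta>)"
    by (simp_all add: dln_beta_def y_def)
  have a: "dln_a \<theta> e 0 = - ((1 + e) / 2) * s" "dln_a \<theta> e 1 = s" "dln_a \<theta> e 2 = - ((1 - e) / 2) * s"
    by (simp_all add: dln_a_def s_def)
  have alpha: "dln_alpha \<theta> 0 = (\<theta> - 1) / 2" "dln_alpha \<theta> 1 = - \<theta>" "dln_alpha \<theta> 2 = (\<theta> + 1) / 2"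
    by (simp_all add: dln_alpha_def)
  define b0 b1 b2 where "b0 = dln_beta \<theta> e 0" and "b1 = dln_beta \<theta> e 1" and "b2 = dln_beta \<theta> e 2"
  have c00: "(\<theta> - 1) / 2 * b0 = - (1 - \<theta>) / 4 + (1 + e)\<^sup>2 / 4 * (\<theta> * y / 2)"
    and c11: "- \<theta> * b1 = (1 - \<theta>) / 4 - (1 + \<theta>) / 4 + \<theta> * y / 2"
    and c22: "(\<theta> + 1) / 2 * b2 = (1 + \<theta>) / 4 + (1 - e)\<^sup>2 / 4 * (\<theta> * y / 2)"
    and c01: "(\<theta> - 1) / 2 * b1 - \<theta> * b0 = - (1 + e) * (\<theta> * y / 2)"
    and c02: "(\<theta> - 1) / 2 * b2 + (\<theta> + 1) / 2 * b0 = (1 + e) * (1 - e) / 2 * (\<theta> * y / 2)"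
    and c12: "- \<theta> * b2 + (\<theta> + 1) / 2 * b1 = - (1 - e) * (\<theta> * y / 2)"
    using y unfolding b0_def b1_def b2_def beta by (simp_all add: field_simps power2_eq_square)
  have sq: "p * s * (q * s) = p * q * (\<theta> * y / 2)" "p * s * s = p * (\<theta> * y / 2)"
    "s * (q * s) = q * (\<theta> * y / 2)" for p q
    by (simp_all flip: s2)
  have c01': "(\<theta> - 1) / 2 * b1 + - \<theta> * b0 = - (1 + e) * (\<theta> * y / 2)"
    using c01 by simp
  show ?thesis
    unfolding inner_three_term_combinations a alpha sq s2 b0_def[symmetric] b1_def[symmetric] b2_def[symmetric]
      c00 c11 c22 c01' c02 c12
    by (simp add: field_simps power2_eq_square)
qed

text \<open>The coefficients are bounded uniformly in the step variability \<open>e\<close>, and the weight of the old values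
  never degenerates: for \<open>\<theta> < 1\<close> one has \<open>\<beta>\<^sub>0 \<ge> (1 - \<theta>) / 4\<close>, and for \<open>\<theta> = 1\<close> the method is the
  midpoint rule with \<open>\<beta>\<^sub>1 = 1/2\<close>.  The last two bounds express that the contribution of the old values is
  controlled by the old energy; for \<open>\<theta> = 1\<close> this energy ignores \<open>u\<^bsub>n-1\<^esub>\<close>, and so does the method.\<close>

lemma dln_beta_bounds:
  fixes \<theta> :: real
  assumes \<theta>: "0 \<le> \<theta>" "\<theta> \<le> 1"
  obtains B b K :: real where "B > 0" "b > 0" "K > 0"
    "\<And>e. \<bar>e\<bar> < 1 \<Longrightarrow> (dln_beta \<theta> e 2)\<^sup>2 \<le> B"
    "\<And>e. \<bar>e\<bar> < 1 \<Longrightarrow> b \<le> (dln_beta \<theta> e 0)\<^sup>2 + (dln_beta \<theta> e 1)\<^sup>2"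
    "\<And>e. \<bar>e\<bar> < 1 \<Longrightarrow> 2 * (dln_beta \<theta> e 1)\<^sup>2 \<le> K * ((1 + \<theta>) / 4)"
    "\<And>e. \<bar>e\<bar> < 1 \<Longrightarrow> 2 * (dln_beta \<theta> e 0)\<^sup>2 \<le> K * ((1 - \<theta>) / 4)"
proof (cases "\<theta> = 1")
  case True
  show thesis
    by (rule that[of "1/4" "1/4" 1]) (simp_all add: True dln_beta_def power2_eq_square)
next
  case False
  then have lt: "\<theta> < 1" using \<theta> by simp
  \<comment> \<open>\<open>Y\<close> bounds the quotient \<open>(1 - \<theta>\<^sup>2) / (1 + e \<theta>)\<^sup>2\<close>, whose supremum over \<open>e\<close> is \<open>(1 + \<theta>) / (1 - \<theta>)\<close>.\<close>
  define Y where "Y = 2 / (1 - \<theta>)"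
  have Y: "Y > 0" using lt by (simp add: Y_def)
  have bounds: "\<bar>dln_beta \<theta> e 0\<bar> \<le> 1 + Y" "\<bar>dln_beta \<theta> e 1\<bar> \<le> 1 + Y" "\<bar>dln_beta \<theta> e 2\<bar> \<le> 1 + Y"
    "dln_beta \<theta> e 0 \<ge> (1 - \<theta>) / 4" if e: "\<bar>e\<bar> < 1" for e
  proof -
    define y where "y = (1 - \<theta>\<^sup>2) / (1 + e * \<theta>)\<^sup>2"
    have "(-1) * \<theta> \<le> e * \<theta>" using e \<theta> by (intro mult_right_mono) auto
    then have den: "1 - \<theta> \<le> 1 + e * \<theta>" by simp
    have fac: "1 - \<theta>\<^sup>2 = (1 - \<theta>) * (1 + \<theta>)" by (simp add: power2_eq_square algebra_simps)
    have y0: "y \<ge> 0" unfolding y_def fac using \<theta> by simp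
    have "y \<le> (1 - \<theta>\<^sup>2) / (1 - \<theta>)\<^sup>2"
      unfolding y_def using den lt \<theta> by (intro divide_left_mono power_mono) (auto simp: fac)
    also have "\<dots> = (1 + \<theta>) / (1 - \<theta>)" using lt by (subst fac) (simp add: power2_eq_square)
    also have "\<dots> \<le> Y" unfolding Y_def using lt \<theta> by (intro divide_right_mono) auto
    finally have yY: "y \<le> Y" .
    have "e\<^sup>2 \<le> 1" using e by (simp add: abs_square_le_1 less_imp_le)
    then have "e\<^sup>2 * \<theta> \<le> 1 * 1" using \<theta> by (intro mult_mono) auto
    define W where "W = e\<^sup>2 * \<theta> * y"
    have w: "W \<le> y" unfolding W_def using \<open>e\<^sup>2 * \<theta> \<le> 1 * 1\<close> y0 mult_right_mono[of "e\<^sup>2 * \<theta>" 1 y] by simp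
    have w0: "0 \<le> W" unfolding W_def using \<theta> y0 by simp
    have beta: "dln_beta \<theta> e 0 = 1/4 * (1 + y - W - \<theta>)"
      "dln_beta \<theta> e 1 = 1/2 * (1 - y)"
      "dln_beta \<theta> e 2 = 1/4 * (1 + y + W + \<theta>)"
      by (simp_all add: dln_beta_def y_def W_def)
    show "\<bar>dln_beta \<theta> e 0\<bar> \<le> 1 + Y" "\<bar>dln_beta \<theta> e 1\<bar> \<le> 1 + Y" "\<bar>dln_beta \<theta> e 2\<bar> \<le> 1 + Y"
      "dln_beta \<theta> e 0 \<ge> (1 - \<theta>) / 4"
      unfolding beta using w w0 y0 yY \<theta> by (simp_all add: abs_le_iff)
  qed
  then have sq: "(dln_beta \<theta> e 0)\<^sup>2 \<le> (1 + Y)\<^sup>2" "(dln_beta \<theta> e 1)\<^sup>2 \<le> (1 + Y)\<^sup>2"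
    "(dln_beta \<theta> e 2)\<^sup>2 \<le> (1 + Y)\<^sup>2" if "\<bar>e\<bar> < 1" for e
    using that Y by (auto simp: abs_le_square_iff[symmetric])
  show thesis
  proof (rule that[of "(1 + Y)\<^sup>2" "((1 - \<theta>) / 4)\<^sup>2" "8 * (1 + Y)\<^sup>2 / (1 - \<theta>)"])
    fix e :: real assume e: "\<bar>e\<bar> < 1"
    show "(dln_beta \<theta> e 2)\<^sup>2 \<le> (1 + Y)\<^sup>2" by (rule sq(3)[OF e])
    have "((1 - \<theta>) / 4)\<^sup>2 \<le> (dln_beta \<theta> e 0)\<^sup>2"
      using bounds(4)[OF e] lt by (intro power_mono) auto
    then show "((1 - \<theta>) / 4)\<^sup>2 \<le> (dln_beta \<theta> e 0)\<^sup>2 + (dln_beta \<theta> e 1)\<^sup>2"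
      by (simp add: add_increasing2)
    have K: "8 * (1 + Y)\<^sup>2 / (1 - \<theta>) * ((1 - \<theta>) / 4) = 2 * (1 + Y)\<^sup>2"
      using lt by (simp add: field_simps)
    show "2 * (dln_beta \<theta> e 0)\<^sup>2 \<le> 8 * (1 + Y)\<^sup>2 / (1 - \<theta>) * ((1 - \<theta>) / 4)"
      unfolding K using sq(1)[OF e] by simp
    have "8 * (1 + Y)\<^sup>2 / (1 - \<theta>) * ((1 - \<theta>) / 4) \<le> 8 * (1 + Y)\<^sup>2 / (1 - \<theta>) * ((1 + \<theta>) / 4)"
      using lt \<theta> by (intro mult_left_mono) auto
    then show "2 * (dln_beta \<theta> e 1)\<^sup>2 \<le> 8 * (1 + Y)\<^sup>2 / (1 - \<theta>) * ((1 + \<theta>) / 4)"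
      using sq(2)[OF e] unfolding K by linarith
  qed (use Y lt in auto)
qed

text \<open>A rate \<open>\<Lambda>\<close> such that one step multiplies the energy by at most \<open>exp (\<Lambda> z)\<close>, where \<open>z\<close> stands for
  \<open>\<bar>\<rho>\<bar>\<close> times the averaged step.  The numbers \<open>A2\<close>, \<open>A1\<close>, \<open>A0\<close> and \<open>U\<close> stand for the squared norms of \<open>u\<^bsub>n+1\<^esub>\<close>,
  \<open>u\<^sub>n\<close>, \<open>u\<^bsub>n-1\<^esub>\<close> and \<open>u\<^bsub>n,\<beta>\<^esub>\<close>, the number \<open>S\<close> for the dissipation and \<open>g\<close> for the forcing.  The bound on \<open>U\<close> is a
  Young inequality whose weight \<open>\<kappa>\<close> is left free.\<close>

definition dln_growth_rate :: "real \<Rightarrow> real \<Rightarrow> bool" where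
  "dln_growth_rate \<theta> \<Lambda> \<longleftrightarrow> (\<forall>e z A2 A1 A0 U S g.
     \<bar>e\<bar> < 1 \<longrightarrow> 0 \<le> z \<longrightarrow> (\<Sum>l\<le>2. (dln_beta \<theta> e l)\<^sup>2) * z \<le> (1 + \<theta>) / 4 \<longrightarrow>
     0 \<le> A2 \<longrightarrow> 0 \<le> A1 \<longrightarrow> 0 \<le> A0 \<longrightarrow> 0 \<le> S \<longrightarrow> 0 \<le> g \<longrightarrow>
     (\<forall>\<kappa>>0. U \<le> (1 + \<kappa>) * (dln_beta \<theta> e 2)\<^sup>2 * A2
        + (1 + 1 / \<kappa>) * (2 * (dln_beta \<theta> e 1)\<^sup>2 * A1 + 2 * (dln_beta \<theta> e 0)\<^sup>2 * A0)) \<longrightarrow>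
     ((1 + \<theta>) / 4 * A2 + (1 - \<theta>) / 4 * A1) + S
       \<le> ((1 + \<theta>) / 4 * A1 + (1 - \<theta>) / 4 * A0) + z * U + g \<longrightarrow>
     ((1 + \<theta>) / 4 * A2 + (1 - \<theta>) / 4 * A1) + S
       \<le> exp (\<Lambda> * z) * (((1 + \<theta>) / 4 * A1 + (1 - \<theta>) / 4 * A0) + g))"

text \<open>With the weight \<open>\<kappa>\<close> chosen below, \<open>(1 + \<kappa>) \<beta>\<^sub>2\<^sup>2 \<le> (1 - \<kappa>) (\<beta>\<^sub>0\<^sup>2 + \<beta>\<^sub>1\<^sup>2 + \<beta>\<^sub>2\<^sup>2)\<close>.  By the step size
  restriction the implicit part of the reaction term is then at most \<open>w\<close> times the new energy with
  \<open>w \<le> 1 - \<kappa>\<close>, and also \<open>w = O(z)\<close>, so that division by \<open>1 - w\<close> costs only a factor \<open>exp (w / \<kappa>)\<close>.\<close>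

lemma dln_growth_rate_exists:
  fixes \<theta> :: real
  assumes \<theta>: "0 \<le> \<theta>" "\<theta> \<le> 1"
  obtains \<Lambda> where "\<Lambda> > 0" "dln_growth_rate \<theta> \<Lambda>"
proof -
  obtain B b K :: real where pos: "B > 0" "b > 0" "K > 0"
    and b2: "\<And>e. \<bar>e\<bar> < 1 \<Longrightarrow> (dln_beta \<theta> e 2)\<^sup>2 \<le> B"
    and b01: "\<And>e. \<bar>e\<bar> < 1 \<Longrightarrow> b \<le> (dln_beta \<theta> e 0)\<^sup>2 + (dln_beta \<theta> e 1)\<^sup>2"
    and b1: "\<And>e. \<bar>e\<bar> < 1 \<Longrightarrow> 2 * (dln_beta \<theta> e 1)\<^sup>2 \<le> K * ((1 + \<theta>) / 4)"
    and b0: "\<And>e. \<bar>e\<bar> < 1 \<Longrightarrow> 2 * (dln_beta \<theta> e 0)\<^sup>2 \<le> K * ((1 - \<theta>) / 4)"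
    by (rule dln_beta_bounds[OF \<theta>]) (rule that)
  \<comment> \<open>The solution of \<open>2 \<kappa> B = (1 - \<kappa>) b\<close>, the worst case of \<open>2 \<kappa> \<beta>\<^sub>2\<^sup>2 \<le> (1 - \<kappa>) (\<beta>\<^sub>0\<^sup>2 + \<beta>\<^sub>1\<^sup>2)\<close>.\<close>
  define \<kappa> where "\<kappa> = b / (2 * B + b)"
  have \<kappa>: "0 < \<kappa>" "\<kappa> < 1" and \<kappa>B: "(1 - \<kappa>) * b = 2 * \<kappa> * B"
    using pos by (simp_all add: \<kappa>_def field_simps)
  define K2 where "K2 = (1 + 1 / \<kappa>) * K"
  define \<Lambda> where "\<Lambda> = K2 + 8 * B / \<kappa>"
  have K2: "K2 > 0" using pos \<kappa> by (auto simp: K2_def intro!: mult_pos_pos add_pos_pos)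
  have \<Lambda>: "\<Lambda> > 0" using K2 pos \<kappa> by (simp add: \<Lambda>_def add_pos_pos)
  have "dln_growth_rate \<theta> \<Lambda>"
    unfolding dln_growth_rate_def
  proof (intro allI impI)
    fix e z A2 A1 A0 U S g :: real
    assume e: "\<bar>e\<bar> < 1" and z: "0 \<le> z" and step: "(\<Sum>l\<le>2. (dln_beta \<theta> e l)\<^sup>2) * z \<le> (1 + \<theta>) / 4"
      and A: "0 \<le> A2" "0 \<le> A1" "0 \<le> A0" and S: "0 \<le> S" and g: "0 \<le> g"
      and U: "\<forall>\<kappa>>0. U \<le> (1 + \<kappa>) * (dln_beta \<theta> e 2)\<^sup>2 * A2
            + (1 + 1 / \<kappa>) * (2 * (dln_beta \<theta> e 1)\<^sup>2 * A1 + 2 * (dln_beta \<theta> e 0)\<^sup>2 * A0)"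
      and energy: "((1 + \<theta>) / 4 * A2 + (1 - \<theta>) / 4 * A1) + S
         \<le> ((1 + \<theta>) / 4 * A1 + (1 - \<theta>) / 4 * A0) + z * U + g"
    define E2 where "E2 = (1 + \<theta>) / 4 * A2 + (1 - \<theta>) / 4 * A1"
    define E1 where "E1 = (1 + \<theta>) / 4 * A1 + (1 - \<theta>) / 4 * A0"
    define p where "p = (dln_beta \<theta> e 2)\<^sup>2"
    define q where "q = (dln_beta \<theta> e 0)\<^sup>2 + (dln_beta \<theta> e 1)\<^sup>2"
    have E: "0 \<le> E2" "0 \<le> E1" using A \<theta> by (auto simp: E2_def E1_def)
    have p: "0 \<le> p" "p \<le> B" and q: "b \<le> q" using b2[OF e] b01[OF e] by (auto simp: p_def q_def)
    \<comment> \<open>the share of the new energy \<open>E2\<close> that the implicit part of \<open>z U\<close> may consume\<close>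
    define w where "w = z * ((1 + \<kappa>) * p) / ((1 + \<theta>) / 4)"
    have w0: "0 \<le> w" using z p \<kappa> \<theta> by (simp add: w_def)
    have "2 * \<kappa> * p \<le> (1 - \<kappa>) * q"
    proof -
      have "2 * \<kappa> * p \<le> 2 * \<kappa> * B" using \<kappa> p by (intro mult_left_mono) auto
      also have "\<dots> = (1 - \<kappa>) * b" by (rule \<kappa>B[symmetric])
      also have "\<dots> \<le> (1 - \<kappa>) * q" using \<kappa> q by (intro mult_left_mono) auto
      finally show ?thesis .
    qed
    then have pq: "(1 + \<kappa>) * p \<le> (1 - \<kappa>) * (p + q)" by (simp add: algebra_simps)
    have "z * ((1 + \<kappa>) * p) \<le> (1 - \<kappa>) * (z * (p + q))"
      using mult_left_mono[OF pq z] by (simp add: algebra_simps)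
    also have "\<dots> \<le> (1 - \<kappa>) * ((1 + \<theta>) / 4)"
    proof (intro mult_left_mono)
      have "(\<Sum>l\<le>2. (dln_beta \<theta> e l)\<^sup>2) = p + q"
        by (simp add: p_def q_def numeral_2_eq_2)
      then show "z * (p + q) \<le> (1 + \<theta>) / 4" using step by (simp add: mult.commute)
    qed (use \<kappa> in simp)
    finally have w1: "w \<le> 1 - \<kappa>" using \<theta> by (simp add: w_def divide_le_eq)
    have "(1 + \<kappa>) * p \<le> 2 * B" using \<kappa> p by (intro mult_mono) auto
    then have "z * ((1 + \<kappa>) * p) \<le> z * (2 * B)" using z by (rule mult_left_mono)
    also have "\<dots> \<le> z * (2 * B) * (1 + \<theta>)" using mult_left_mono[of 1 "1 + \<theta>" "z * (2 * B)"] z pos \<theta> by simp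
    also have "\<dots> = 8 * B * z * ((1 + \<theta>) / 4)" by simp
    finally have "z * ((1 + \<kappa>) * p) \<le> 8 * B * z * ((1 + \<theta>) / 4)" .
    then have w2: "w \<le> 8 * B * z" unfolding w_def by (subst pos_divide_le_eq) (use \<theta> in auto)
    have "2 * (dln_beta \<theta> e 1)\<^sup>2 * A1 + 2 * (dln_beta \<theta> e 0)\<^sup>2 * A0
        \<le> K * ((1 + \<theta>) / 4) * A1 + K * ((1 - \<theta>) / 4) * A0"
      using b1[OF e] b0[OF e] A by (intro add_mono mult_right_mono) auto
    also have "\<dots> = K * E1" by (simp add: E1_def algebra_simps)
    finally have "(1 + 1 / \<kappa>) * (2 * (dln_beta \<theta> e 1)\<^sup>2 * A1 + 2 * (dln_beta \<theta> e 0)\<^sup>2 * A0) \<le> K2 * E1"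
      using \<kappa> unfolding K2_def mult.assoc by (intro mult_left_mono) auto
    then have "U \<le> (1 + \<kappa>) * p * A2 + K2 * E1"
      using U[rule_format, OF \<kappa>(1)] by (simp add: p_def)
    from mult_left_mono[OF this z]
    have "z * U \<le> z * ((1 + \<kappa>) * p) * A2 + K2 * z * E1" by (simp add: algebra_simps)
    also have "z * ((1 + \<kappa>) * p) * A2 = w * ((1 + \<theta>) / 4 * A2)" using \<theta> by (simp add: w_def)
    also have "\<dots> \<le> w * E2"
      using w0 A \<theta> by (intro mult_left_mono) (simp_all add: E2_def)
    finally have "E2 + S \<le> E1 + (w * E2 + K2 * z * E1) + g"
      using energy by (simp add: E2_def E1_def)
    then have "(1 - w) * E2 + S \<le> (1 + K2 * z) * E1 + g" by (simp add: algebra_simps)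
    moreover have "(1 - w) * S \<le> S" using w0 S by (simp add: mult_left_le_one_le algebra_simps)
    moreover have "g \<le> (1 + K2 * z) * g" using K2 z g by (simp add: algebra_simps)
    ultimately have main: "(1 - w) * (E2 + S) \<le> (1 + K2 * z) * (E1 + g)"
      by (simp add: distrib_left)
    have "1 \<le> (1 + w / \<kappa>) * (1 - w)"
    proof -
      have "0 \<le> w * ((1 - \<kappa>) - w)" using w0 w1 by simp
      then have "\<kappa> \<le> (\<kappa> + w) * (1 - w)" by (simp add: algebra_simps)
      then show ?thesis using \<kappa> by (simp add: field_simps)
    qed
    then have "1 * (E2 + S) \<le> (1 + w / \<kappa>) * (1 - w) * (E2 + S)"
      using E S by (intro mult_right_mono) auto
    also have "\<dots> \<le> (1 + w / \<kappa>) * ((1 + K2 * z) * (E1 + g))"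
      unfolding mult.assoc using main w0 \<kappa> by (intro mult_left_mono) auto
    also have "\<dots> \<le> exp (w / \<kappa>) * (exp (K2 * z) * (E1 + g))"
      using E g K2 z w0 \<kappa> by (intro mult_mono mult_right_mono exp_ge_add_one_self) auto
    also have "\<dots> = exp (w / \<kappa> + K2 * z) * (E1 + g)" by (simp add: exp_add)
    also have "\<dots> \<le> exp (\<Lambda> * z) * (E1 + g)"
    proof (intro mult_right_mono)
      have "w / \<kappa> \<le> 8 * B * z / \<kappa>" using w2 \<kappa> by (intro divide_right_mono) auto
      then show "exp (w / \<kappa> + K2 * z) \<le> exp (\<Lambda> * z)" by (simp add: \<Lambda>_def algebra_simps)
    qed (use E g in simp)
    finally show "((1 + \<theta>) / 4 * A2 + (1 - \<theta>) / 4 * A1) + S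
         \<le> exp (\<Lambda> * z) * (((1 + \<theta>) / 4 * A1 + (1 - \<theta>) / 4 * A0) + g)"
      by (simp add: E2_def E1_def)
  qed
  with \<Lambda> show thesis by (rule that)
qed

section \<open>Discrete Gronwall argument on the time grid\<close>

lemma discrete_gronwall:
  fixes E S g c :: "nat \<Rightarrow> real"
  assumes "m \<ge> 1"
    and step: "\<And>n. 1 \<le> n \<Longrightarrow> n < m \<Longrightarrow> E (n + 1) + S n \<le> exp (c n) * (E n + g n)"
    and nonneg: "\<And>n. 1 \<le> n \<Longrightarrow> n < m \<Longrightarrow> 0 \<le> c n \<and> 0 \<le> S n \<and> 0 \<le> g n"
  shows "E m + (\<Sum>n=1..<m. S n) \<le> exp (\<Sum>n=1..<m. c n) * (E 1 + (\<Sum>n=1..<m. g n))"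
  using assms
proof (induction m rule: nat_induct_at_least)
  case (Suc m)
  define X where "X = exp (\<Sum>n=1..<m. c n)"
  have IH: "E m + (\<Sum>n=1..<m. S n) \<le> X * (E 1 + (\<Sum>n=1..<m. g n))"
    unfolding X_def using Suc by simp
  have c: "1 \<le> exp (c m)" and S: "0 \<le> (\<Sum>n=1..<m. S n)" and X: "1 \<le> X" and g: "0 \<le> g m"
    using Suc by (auto simp: X_def intro!: sum_nonneg)
  have "E (Suc m) + (\<Sum>n=1..<Suc m. S n) \<le> exp (c m) * (E m + g m) + 1 * (\<Sum>n=1..<m. S n)"
    using Suc.prems(1)[of m] Suc.hyps by simp
  also have "\<dots> \<le> exp (c m) * (E m + g m) + exp (c m) * (\<Sum>n=1..<m. S n)"
    using c S by (intro add_left_mono mult_right_mono)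
  also have "\<dots> = exp (c m) * ((E m + (\<Sum>n=1..<m. S n)) + 1 * g m)"
    by (simp add: algebra_simps)
  also have "\<dots> \<le> exp (c m) * (X * (E 1 + (\<Sum>n=1..<m. g n)) + X * g m)"
    using IH X g by (intro mult_left_mono add_mono mult_right_mono) auto
  also have "\<dots> = exp (\<Sum>n=1..<Suc m. c n) * (E 1 + (\<Sum>n=1..<Suc m. g n))"
    using Suc.hyps by (simp add: X_def exp_add algebra_simps)
  finally show ?case .
qed simp

lemma tstep_pos: "time_grid T M t \<Longrightarrow> n < M \<Longrightarrow> tstep t n > 0"
  by (simp add: time_grid_def tstep_def)

lemma abs_step_var_less_1:
  assumes "time_grid T M t" "1 \<le> n" "n < M"
  shows "\<bar>step_var t n\<bar> < 1"
proof -
  have "tstep t n > 0" "tstep t (n - 1) > 0"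
    using assms(2,3) by (auto intro: tstep_pos[OF assms(1)])
  then show ?thesis by (simp add: step_var_def abs_less_iff divide_simps)
qed

lemma avg_step_pos:
  assumes "time_grid T M t" "1 \<le> n" "n < M" "0 \<le> \<theta>" "\<theta> \<le> 1"
  shows "avg_step \<theta> t n > 0"
proof -
  have "tstep t n > 0" "tstep t (n - 1) > 0"
    using assms(2,3) by (auto intro: tstep_pos[OF assms(1)])
  then have "(1 + \<theta>) / 2 * tstep t n > 0" "(1 - \<theta>) / 2 * tstep t (n - 1) \<ge> 0"
    using assms(4,5) by simp_all
  then show ?thesis by (simp add: avg_step_def dln_alpha_def algebra_simps)
qed

lemma time_grid_mono:
  assumes "time_grid T M t" "i \<le> j" "j \<le> M"
  shows "t i \<le> t j"
  using assms(2,3)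
proof (induction j rule: dec_induct)
  case (step j)
  moreover have "t j < t (Suc j)" using step.prems assms(1) by (simp add: time_grid_def)
  ultimately show ?case by simp
qed simp

text \<open>The averaged step is the convex combination of \<open>k\<^sub>n\<close> and \<open>k\<^bsub>n-1\<^esub>\<close> with weights \<open>(1 + \<theta>) / 2\<close> and
  \<open>(1 - \<theta>) / 2\<close>, and both sums telescope.\<close>

lemma sum_avg_step_le:
  assumes grid: "time_grid T M t" and m: "1 \<le> m" "m \<le> M" and \<theta>: "0 \<le> \<theta>" "\<theta> \<le> 1"
  shows "(\<Sum>n=1..<m. avg_step \<theta> t n) \<le> T"
proof -
  have "(\<Sum>n=1..<m. avg_step \<theta> t n) = (1 + \<theta>) / 2 * (t m - t 1) + (1 - \<theta>) / 2 * (t (m - 1) - t 0)"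
    using m(1)
  proof (induction m rule: nat_induct_at_least)
    case (Suc m)
    then show ?case
      by (cases m) (simp_all add: avg_step_def dln_alpha_def tstep_def field_simps)
  qed simp
  also have "\<dots> \<le> (1 + \<theta>) / 2 * T + (1 - \<theta>) / 2 * T"
    using time_grid_mono[OF grid, of m M] time_grid_mono[OF grid, of 0 1]
      time_grid_mono[OF grid, of "m - 1" M] m \<theta> grid
    by (intro add_mono mult_left_mono) (auto simp: time_grid_def)
  also have "\<dots> = T" by (simp add: field_simps)
  finally show ?thesis .
qed

section \<open>The energy estimate\<close>

context bounded_open_set
begin

lemma l2_inner_alpha_beta:
  fixes z :: "nat \<Rightarrow> real^2 \<Rightarrow> real^2"
  assumes e: "\<bar>step_var t n\<bar> < 1" and \<theta>: "0 \<le> \<theta>" "\<theta> \<le> 1" and n: "1 \<le> n"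
    and L2: "z (n - 1) \<in> L2_space D" "z n \<in> L2_space D" "z (n + 1) \<in> L2_space D"
  shows "l2_inner D (alpha_comb \<theta> z n) (beta_comb \<theta> t z n)
     = ((1 + \<theta>) / 4 * (l2_norm D (z (n + 1)))\<^sup>2 + (1 - \<theta>) / 4 * (l2_norm D (z n))\<^sup>2)
       - ((1 + \<theta>) / 4 * (l2_norm D (z n))\<^sup>2 + (1 - \<theta>) / 4 * (l2_norm D (z (n - 1)))\<^sup>2)
       + (l2_norm D (a_comb \<theta> t z n))\<^sup>2"
proof -
  have a: "a_comb \<theta> t z n \<in> L2_space D"
    unfolding a_comb_def using L2 n by (intro three_point_closed[OF lincomb_closed_L2])
  note int = L2_integrable_inner[OF L2(1) L2(1)] L2_integrable_inner[OF L2(2) L2(2)]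
    L2_integrable_inner[OF L2(3) L2(3)] L2_integrable_inner[OF a a]
  have "l2_inner D (alpha_comb \<theta> z n) (beta_comb \<theta> t z n)
      = (\<integral>x. ((1 + \<theta>) / 4 * (z (n + 1) x \<bullet> z (n + 1) x) + (1 - \<theta>) / 4 * (z n x \<bullet> z n x))
         - ((1 + \<theta>) / 4 * (z n x \<bullet> z n x) + (1 - \<theta>) / 4 * (z (n - 1) x \<bullet> z (n - 1) x))
         + a_comb \<theta> t z n x \<bullet> a_comb \<theta> t z n x \<partial>lebesgue_on D)"
    unfolding l2_inner_def alpha_comb_def beta_comb_def a_comb_def three_point_expand[OF n]
    by (simp only: dln_G_identity[OF e \<theta>])
  also have "\<dots> = ((1 + \<theta>) / 4 * l2_inner D (z (n + 1)) (z (n + 1)) + (1 - \<theta>) / 4 * l2_inner D (z n) (z n))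
       - ((1 + \<theta>) / 4 * l2_inner D (z n) (z n) + (1 - \<theta>) / 4 * l2_inner D (z (n - 1)) (z (n - 1)))
       + l2_inner D (a_comb \<theta> t z n) (a_comb \<theta> t z n)"
    unfolding l2_inner_def using int by simp
  finally show ?thesis by (simp add: l2_norm_sq)
qed

text \<open>Young's inequality separates the new value from the two old ones; a small \<open>\<kappa>\<close> keeps the factor of
  the new value close to \<open>(c 2)\<^sup>2\<close>.\<close>

lemma l2_norm_three_point_le:
  fixes z :: "nat \<Rightarrow> real^2 \<Rightarrow> real^2"
  assumes n: "1 \<le> n" and \<kappa>: "\<kappa> > 0"
    and L2: "z (n - 1) \<in> L2_space D" "z n \<in> L2_space D" "z (n + 1) \<in> L2_space D"
  shows "(l2_norm D (three_point c z n))\<^sup>2 \<le> (1 + \<kappa>) * (c 2)\<^sup>2 * (l2_norm D (z (n + 1)))\<^sup>2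
    + (1 + 1 / \<kappa>) * (2 * (c 1)\<^sup>2 * (l2_norm D (z n))\<^sup>2 + 2 * (c 0)\<^sup>2 * (l2_norm D (z (n - 1)))\<^sup>2)"
proof -
  have young: "(p + q) \<bullet> (p + q) \<le> (1 + 1 / \<kappa>) * (p \<bullet> p) + (1 + \<kappa>) * (q \<bullet> q)" for p q :: "real^2"
  proof -
    have "0 \<le> ((1 / \<kappa>) *\<^sub>R p - q) \<bullet> ((1 / \<kappa>) *\<^sub>R p - q) * \<kappa>" using \<kappa> by simp
    also have "\<dots> = (1 / \<kappa>) * (p \<bullet> p) - 2 * (p \<bullet> q) + \<kappa> * (q \<bullet> q)"
      using \<kappa> by (simp add: inner_diff_left inner_diff_right inner_commute[of q p] field_simps)
    finally show ?thesis
      by (simp add: inner_add_left inner_add_right inner_commute[of q p] algebra_simps)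
  qed
  have pq: "(p + q) \<bullet> (p + q) \<le> 2 * (p \<bullet> p) + 2 * (q \<bullet> q)" for p q :: "real^2"
    using inner_ge_zero[of "p - q"]
    by (simp add: inner_add_left inner_add_right inner_diff_left inner_diff_right inner_commute[of q p])
  have "three_point c z n x \<bullet> three_point c z n x \<le> (1 + \<kappa>) * (c 2)\<^sup>2 * (z (n + 1) x \<bullet> z (n + 1) x)
    + (1 + 1 / \<kappa>) * (2 * (c 1)\<^sup>2 * (z n x \<bullet> z n x) + 2 * (c 0)\<^sup>2 * (z (n - 1) x \<bullet> z (n - 1) x))" for x
  proof -
    let ?r = "c 0 *\<^sub>R z (n - 1) x + c 1 *\<^sub>R z n x"
    have "three_point c z n x \<bullet> three_point c z n x
        \<le> (1 + 1 / \<kappa>) * (?r \<bullet> ?r) + (1 + \<kappa>) * ((c 2 *\<^sub>R z (n + 1) x) \<bullet> (c 2 *\<^sub>R z (n + 1) x))"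
      unfolding three_point_expand[OF n] by (rule young)
    also have "(1 + 1 / \<kappa>) * (?r \<bullet> ?r) \<le> (1 + 1 / \<kappa>) *
        (2 * ((c 0 *\<^sub>R z (n - 1) x) \<bullet> (c 0 *\<^sub>R z (n - 1) x)) + 2 * ((c 1 *\<^sub>R z n x) \<bullet> (c 1 *\<^sub>R z n x)))"
      using \<kappa> by (intro mult_left_mono pq) auto
    finally show ?thesis by (simp add: power2_eq_square mult.assoc add.commute)
  qed
  then have "l2_inner D (three_point c z n) (three_point c z n)
    \<le> (\<integral>x. (1 + \<kappa>) * (c 2)\<^sup>2 * (z (n + 1) x \<bullet> z (n + 1) x)
    + (1 + 1 / \<kappa>) * (2 * (c 1)\<^sup>2 * (z n x \<bullet> z n x) + 2 * (c 0)\<^sup>2 * (z (n - 1) x \<bullet> z (n - 1) x)) \<partial>lebesgue_on D)"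
    unfolding l2_inner_def using L2 n
    by (intro integral_mono L2_integrable_inner three_point_closed[OF lincomb_closed_L2]
        Bochner_Integration.integrable_add integrable_mult_right)
  also have "\<dots> = (1 + \<kappa>) * (c 2)\<^sup>2 * l2_inner D (z (n + 1)) (z (n + 1))
    + (1 + 1 / \<kappa>) * (2 * (c 1)\<^sup>2 * l2_inner D (z n) (z n) + 2 * (c 0)\<^sup>2 * l2_inner D (z (n - 1)) (z (n - 1)))"
    unfolding l2_inner_def
    using L2_integrable_inner[OF L2(1) L2(1)] L2_integrable_inner[OF L2(2) L2(2)] L2_integrable_inner[OF L2(3) L2(3)]
    by simp
  finally show ?thesis by (simp add: l2_norm_sq)
qed

lemma l2_inner_young:
  fixes f u :: "real^2 \<Rightarrow> 'b::euclidean_space"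
  assumes "f \<in> L2_space D" "u \<in> L2_space D" "c > 0"
  shows "l2_inner D f u \<le> 1 / (2 * c) * (l2_norm D f)\<^sup>2 + c / 2 * (l2_norm D u)\<^sup>2"
proof -
  have "p \<bullet> q \<le> 1 / (2 * c) * (p \<bullet> p) + c / 2 * (q \<bullet> q)" for p q :: 'b
  proof -
    have "0 \<le> ((1 / c) *\<^sub>R p - q) \<bullet> ((1 / c) *\<^sub>R p - q) * (c / 2)" using assms(3) by simp
    also have "\<dots> = 1 / (2 * c) * (p \<bullet> p) - p \<bullet> q + c / 2 * (q \<bullet> q)"
      using assms(3) by (simp add: inner_diff_left inner_diff_right inner_commute[of q p] field_simps)
    finally show ?thesis by simp
  qed
  then have "l2_inner D f u \<le> (\<integral>x. 1 / (2 * c) * (f x \<bullet> f x) + c / 2 * (u x \<bullet> u x) \<partial>lebesgue_on D)"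
    unfolding l2_inner_def using assms
    by (intro integral_mono L2_integrable_inner Bochner_Integration.integrable_add integrable_mult_right)
  also have "\<dots> = 1 / (2 * c) * l2_inner D f f + c / 2 * l2_inner D u u"
    unfolding l2_inner_def using L2_integrable_inner[OF assms(1,1)] L2_integrable_inner[OF assms(2,2)] by simp
  finally show ?thesis by (simp add: l2_norm_sq)
qed

lemma l4_norm_pow4: "(l4_norm D v) ^ 4 = l2_inner D (\<lambda>x. (norm (v x))\<^sup>2 *\<^sub>R v x) v"
proof -
  have "(l4_norm D v) ^ 4 = (\<integral>x. (norm (v x)) ^ 4 \<partial>lebesgue_on D)"
    by (simp add: l4_norm_def)
  also have "\<dots> = l2_inner D (\<lambda>x. (norm (v x))\<^sup>2 *\<^sub>R v x) v"
    by (simp add: l2_inner_def power4_eq_xxxx power2_eq_square mult.assoc flip: power2_norm_eq_inner)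
  finally show ?thesis .
qed

text \<open>The momentum equation tested with \<open>u\<^bsub>n,\<beta>\<^esub>\<close>, multiplied by the averaged step.\<close>

lemma dln_energy_balance:
  assumes sol: "dln_solution D r \<K> \<mu> \<gamma> \<nu> lam \<rho> \<theta> M t f u w p"
    and grid: "time_grid T M t" and n: "1 \<le> n" "n < M" and \<theta>: "0 \<le> \<theta>" "\<theta> \<le> 1"
  defines "ub \<equiv> beta_comb \<theta> t u n" and "wb \<equiv> beta_comb \<theta> t w n"
  shows "((1 + \<theta>) / 4 * (l2_norm D (u (n + 1)))\<^sup>2 + (1 - \<theta>) / 4 * (l2_norm D (u n))\<^sup>2)
      + (l2_norm D (a_comb \<theta> t u n))\<^sup>2
      + avg_step \<theta> t n * (\<mu> * (l2_norm D (wgrad D ub))\<^sup>2 + \<gamma> * (l2_norm D wb)\<^sup>2 + lam * (l4_norm D ub) ^ 4)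
    = ((1 + \<theta>) / 4 * (l2_norm D (u n))\<^sup>2 + (1 - \<theta>) / 4 * (l2_norm D (u (n - 1)))\<^sup>2)
      + avg_step \<theta> t n * (l2_inner D (beta_comb \<theta> t (\<lambda>n. f (t n)) n) ub - \<rho> * (l2_norm D ub)\<^sup>2)"
proof -
  have le: "n - 1 \<le> M" "n \<le> M" "n + 1 \<le> M" using n by auto
  have uX: "u i \<in> Xh_space D r \<K>" and wV: "w i \<in> Vh_space D r \<K>" and pQ: "p i \<in> Qh_space D r \<K>"
    if "i \<le> M" for i
    using sol that by (auto simp: dln_solution_def)
  have uH1: "u i \<in> H1_space D" if "i \<le> M" for i using uX[OF that] Xh_subset_H1 by blast
  have wL2: "w i \<in> L2_space D" if "i \<le> M" for i
    using wV[OF that] Vh_subset_Xh Xh_subset_H1 H1_imp_L2 by blast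
  have pL2: "p i \<in> L2_space D" if "i \<le> M" for i
    using pQ[OF that] Qh_subset_L2 by blast
  have ubX: "ub \<in> Xh_space D r \<K>"
    unfolding ub_def beta_comb_def by (intro three_point_closed[OF lincomb_closed_Xh] n uX le)
  have wbV: "wb \<in> Vh_space D r \<K>"
    unfolding wb_def beta_comb_def by (intro three_point_closed[OF lincomb_closed_Vh] n wV le)
  have pbQ: "beta_comb \<theta> t p n \<in> Qh_space D r \<K>"
    unfolding beta_comb_def by (intro three_point_closed[OF lincomb_closed_Qh] n pQ le)
  have ubH1: "ub \<in> H1_space D" using ubX Xh_subset_H1 by blast
  have wbH1: "wb \<in> H1_space D" using wbV Vh_subset_Xh Xh_subset_H1 by blast
  have closedH1: "lincomb_closed (H1_space D)" by (simp add: lincomb_closed_def H1_lincomb)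
  have vort: "l2_inner D wb wb = l2_inner D (wgrad D ub) (wgrad D wb)"
  proof -
    have eq: "l2_inner D (w i) wb = l2_inner D (wgrad D (u i)) (wgrad D wb)" if "i \<le> M" for i
      using sol wbV that by (simp add: dln_solution_def)
    have "l2_inner D (three_point (dln_beta \<theta> (step_var t n)) w n) wb
        = l2_inner D (wgrad D (three_point (dln_beta \<theta> (step_var t n)) u n)) (wgrad D wb)"
      using three_point_linear[OF lincomb_closed_L2 n(1), of w "\<lambda>v. l2_inner D v wb" "dln_beta \<theta> (step_var t n)"]
        three_point_linear[OF closedH1 n(1), of u "\<lambda>v. l2_inner D (wgrad D v) (wgrad D wb)" "dln_beta \<theta> (step_var t n)"]
      by (simp add: wL2 uH1 le[simplified] n eq l2_inner_lincomb l2_inner_wgrad_lincomb wbH1 H1_imp_L2 wgrad)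
    then show ?thesis by (simp add: ub_def wb_def beta_comb_def)
  qed
  have incompressible: "l2_inner D (beta_comb \<theta> t p n) (wdiv D ub) = 0"
  proof -
    have "l2_inner D (wdiv D (u i)) (beta_comb \<theta> t p n) = 0" if "i \<le> M" for i
      using sol pbQ that by (simp add: dln_solution_def)
    then have "l2_inner D (wdiv D ub) (beta_comb \<theta> t p n) = 0"
      unfolding ub_def beta_comb_def[of \<theta> t u n]
      using three_point_linear[OF closedH1 n(1), of u "\<lambda>v. l2_inner D (wdiv D v) (beta_comb \<theta> t p n)" "dln_beta \<theta> (step_var t n)"]
        pbQ Qh_subset_L2
      by (simp add: uH1 le[simplified] n l2_inner_wdiv_lincomb subset_iff)
    then show ?thesis by (simp add: l2_inner_commute)
  qed
  have k: "avg_step \<theta> t n > 0" by (rule avg_step_pos[OF grid n \<theta>])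
  \<comment> \<open>the skew-symmetrised form has two equal halves when the last two arguments coincide\<close>
  have "trilin_b D ub ub ub = 0" by (simp add: trilin_b_def)
  moreover have "dln_momentum_eq D \<mu> \<gamma> \<nu> lam \<rho> \<theta> t f u w p n ub"
    using sol ubX n by (simp add: dln_solution_def)
  ultimately have "1 / avg_step \<theta> t n * l2_inner D (alpha_comb \<theta> u n) ub
      + \<mu> * (l2_norm D (wgrad D ub))\<^sup>2 + \<gamma> * (l2_norm D wb)\<^sup>2 + \<rho> * (l2_norm D ub)\<^sup>2
      + lam * (l4_norm D ub) ^ 4
    = l2_inner D (beta_comb \<theta> t (\<lambda>n. f (t n)) n) ub"
    using vort incompressible l2_inner_commute[of D "wgrad D ub" "wgrad D wb"]
    by (simp add: dln_momentum_eq_def Let_def ub_def[symmetric] wb_def[symmetric] l2_norm_sq l4_norm_pow4)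
  then have "l2_inner D (alpha_comb \<theta> u n) ub
      = avg_step \<theta> t n * (l2_inner D (beta_comb \<theta> t (\<lambda>n. f (t n)) n) ub - \<rho> * (l2_norm D ub)\<^sup>2
        - (\<mu> * (l2_norm D (wgrad D ub))\<^sup>2 + \<gamma> * (l2_norm D wb)\<^sup>2 + lam * (l4_norm D ub) ^ 4))"
    using k by (simp add: field_simps)
  moreover have "l2_inner D (alpha_comb \<theta> u n) ub
     = ((1 + \<theta>) / 4 * (l2_norm D (u (n + 1)))\<^sup>2 + (1 - \<theta>) / 4 * (l2_norm D (u n))\<^sup>2)
       - ((1 + \<theta>) / 4 * (l2_norm D (u n))\<^sup>2 + (1 - \<theta>) / 4 * (l2_norm D (u (n - 1)))\<^sup>2)
       + (l2_norm D (a_comb \<theta> t u n))\<^sup>2"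
    unfolding ub_def
    by (intro l2_inner_alpha_beta abs_step_var_less_1[OF grid n] \<theta> n H1_imp_L2 uH1 le)
  ultimately show ?thesis by (simp add: algebra_simps)
qed

text \<open>Half of the viscous term pays for the forcing through Young's inequality with weight \<open>\<mu> / C\<close> and the
  Poincare inequality.\<close>

lemma dln_energy_inequality:
  assumes sol: "dln_solution D r \<K> \<mu> \<gamma> \<nu> lam \<rho> \<theta> M t f u w p"
    and grid: "time_grid T M t" and n: "1 \<le> n" "n < M" and \<theta>: "0 \<le> \<theta>" "\<theta> \<le> 1"
    and f: "\<And>i. i \<le> M \<Longrightarrow> f (t i) \<in> L2_space D"
    and \<mu>: "\<mu> > 0" and C: "C > 0"
    and poincare: "\<And>v. v \<in> X_space D \<Longrightarrow> (l2_norm D v)\<^sup>2 \<le> C * (l2_norm D (wgrad D v))\<^sup>2"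
  defines "ub \<equiv> beta_comb \<theta> t u n" and "wb \<equiv> beta_comb \<theta> t w n"
  shows "((1 + \<theta>) / 4 * (l2_norm D (u (n + 1)))\<^sup>2 + (1 - \<theta>) / 4 * (l2_norm D (u n))\<^sup>2)
      + ((l2_norm D (a_comb \<theta> t u n))\<^sup>2
      + avg_step \<theta> t n * (\<mu> / 2 * (l2_norm D (wgrad D ub))\<^sup>2 + \<gamma> * (l2_norm D wb)\<^sup>2 + lam * (l4_norm D ub) ^ 4))
    \<le> ((1 + \<theta>) / 4 * (l2_norm D (u n))\<^sup>2 + (1 - \<theta>) / 4 * (l2_norm D (u (n - 1)))\<^sup>2)
      + \<bar>\<rho>\<bar> * avg_step \<theta> t n * (l2_norm D ub)\<^sup>2
      + C / 2 / \<mu> * (avg_step \<theta> t n * (l2_norm D (beta_comb \<theta> t (\<lambda>n. f (t n)) n))\<^sup>2)"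
proof -
  define fb where "fb = beta_comb \<theta> t (\<lambda>n. f (t n)) n"
  have le: "n - 1 \<le> M" "n \<le> M" "n + 1 \<le> M" using n by auto
  have k: "avg_step \<theta> t n > 0" by (rule avg_step_pos[OF grid n \<theta>])
  have uX: "u i \<in> Xh_space D r \<K>" if "i \<le> M" for i
    using sol that by (auto simp: dln_solution_def)
  have "ub \<in> Xh_space D r \<K>"
    unfolding ub_def beta_comb_def by (intro three_point_closed[OF lincomb_closed_Xh] n uX le)
  then have ub: "ub \<in> X_space D" "ub \<in> L2_space D"
    using Xh_subset_H1 H1_imp_L2 by (auto simp: Xh_space_def)
  have fb: "fb \<in> L2_space D"
    unfolding fb_def beta_comb_def by (intro three_point_closed[OF lincomb_closed_L2] n f le)
  have "l2_inner D fb ub \<le> C / 2 / \<mu> * (l2_norm D fb)\<^sup>2 + \<mu> / C / 2 * (l2_norm D ub)\<^sup>2"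
    using l2_inner_young[OF fb ub(2), of "\<mu> / C"] \<mu> C by (simp add: mult.commute)
  also have "\<mu> / C / 2 * (l2_norm D ub)\<^sup>2 \<le> \<mu> / C / 2 * (C * (l2_norm D (wgrad D ub))\<^sup>2)"
    using poincare[OF ub(1)] \<mu> C by (intro mult_left_mono) auto
  also have "\<dots> = \<mu> / 2 * (l2_norm D (wgrad D ub))\<^sup>2" using C by simp
  finally have "l2_inner D fb ub \<le> C / 2 / \<mu> * (l2_norm D fb)\<^sup>2 + \<mu> / 2 * (l2_norm D (wgrad D ub))\<^sup>2"
    by simp
  moreover have "- \<rho> * (l2_norm D ub)\<^sup>2 \<le> \<bar>\<rho>\<bar> * (l2_norm D ub)\<^sup>2"
    by (intro mult_right_mono) auto
  ultimately have "l2_inner D fb ub - \<rho> * (l2_norm D ub)\<^sup>2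
      \<le> C / 2 / \<mu> * (l2_norm D fb)\<^sup>2 + \<mu> / 2 * (l2_norm D (wgrad D ub))\<^sup>2 + \<bar>\<rho>\<bar> * (l2_norm D ub)\<^sup>2"
    by simp
  from mult_left_mono[OF this, of "avg_step \<theta> t n"] k
  have "avg_step \<theta> t n * (l2_inner D fb ub - \<rho> * (l2_norm D ub)\<^sup>2)
      \<le> avg_step \<theta> t n * (C / 2 / \<mu> * (l2_norm D fb)\<^sup>2 + \<mu> / 2 * (l2_norm D (wgrad D ub))\<^sup>2 + \<bar>\<rho>\<bar> * (l2_norm D ub)\<^sup>2)"
    by simp
  with dln_energy_balance[OF sol grid n \<theta>, folded ub_def wb_def fb_def]
  show ?thesis unfolding fb_def[symmetric] by (simp add: algebra_simps)
qed

end

theorem theorem3p3: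
  fixes D :: "(real^2) set" and H :: "real set" and \<T> :: "real \<Rightarrow> (real^2) set set" and r :: nat
  assumes "bounded_lipschitz_domain D"
    and "regular_mesh_family D H \<T>"
    and "r \<ge> 1"
    and "discrete_inf_sup D r H \<T>"
  shows "\<exists>C>0. \<forall>\<mu> \<gamma> \<nu> lam \<rho> \<theta> :: real.
    \<mu> > 0 \<and> \<gamma> \<ge> 0 \<and> \<nu> \<ge> 0 \<and> lam \<ge> 0 \<and> 0 \<le> \<theta> \<and> \<theta> \<le> 1 \<longrightarrow>
    (\<exists>C\<theta>>0. \<forall>(T::real) (M::nat) t f h u w p.
      T > 0 \<and> time_grid T M t \<and>
      bochner_L2 T D f \<and> (\<forall>n\<le>M. f (t n) \<in> L2_space D) \<and>
      h \<in> H \<and>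
      (\<forall>n\<in>{1..<M}. C_beta \<theta> t n * \<bar>\<rho>\<bar> * avg_step \<theta> t n \<le> (1 + \<theta>) / 4) \<and>
      dln_solution D r (\<T> h) \<mu> \<gamma> \<nu> lam \<rho> \<theta> M t f u w p \<longrightarrow>
      (\<forall>m. 1 < m \<and> m \<le> M \<longrightarrow>
        (1 + \<theta>) / 4 * (l2_norm D (u m))\<^sup>2
        + (\<Sum>n = 1..m - 1.
             (l2_norm D (a_comb \<theta> t u n))\<^sup>2
             + avg_step \<theta> t n *
                 (\<mu> / 2 * (l2_norm D (wgrad D (beta_comb \<theta> t u n)))\<^sup>2
                  + \<gamma> * (l2_norm D (beta_comb \<theta> t w n))\<^sup>2
                  + lam * (l4_norm D (beta_comb \<theta> t u n)) ^ 4))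
        \<le> exp (C\<theta> * T) *
            ((1 + \<theta>) / 4 * (l2_norm D (u 1))\<^sup>2 + (1 + \<theta>) / 4 * (l2_norm D (u 0))\<^sup>2
             + C / \<mu> * (\<Sum>n = 1..m - 1.
                 avg_step \<theta> t n * (l2_norm D (beta_comb \<theta> t (\<lambda>n. f (t n)) n))\<^sup>2))))"
proof -
  interpret bounded_open_set D
    using assms(1) by unfold_locales (auto simp: bounded_lipschitz_domain_def)
  obtain C where C: "C > 0"
    and poincare: "\<And>v. v \<in> X_space D \<Longrightarrow> (l2_norm D v)\<^sup>2 \<le> C * (l2_norm D (wgrad D v))\<^sup>2"
    by (rule poincare_X) (rule that)
  show ?thesis
  proof (rule exI[of _ "C / 2"], intro conjI allI impI; (elim conjE)?)
    show "C / 2 > 0" using C by simp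
    fix \<mu> \<gamma> \<nu> lam \<rho> \<theta> :: real
    assume \<mu>: "\<mu> > 0" and \<gamma>: "\<gamma> \<ge> 0" and lam: "lam \<ge> 0" and \<theta>: "0 \<le> \<theta>" "\<theta> \<le> 1"
    obtain \<Lambda> where \<Lambda>: "\<Lambda> > 0" "dln_growth_rate \<theta> \<Lambda>"
      by (rule dln_growth_rate_exists[OF \<theta>])
    note growth = \<Lambda>(2)[unfolded dln_growth_rate_def, rule_format]
    \<comment> \<open>The summand \<open>1\<close> keeps the constant positive when \<open>\<rho> = 0\<close>.\<close>
    define C\<theta> where "C\<theta> = \<Lambda> * \<bar>\<rho>\<bar> + 1"
    show "\<exists>C\<theta>>0. \<forall>(T::real) (M::nat) t f h u w p.
      T > 0 \<and> time_grid T M t \<and>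
      bochner_L2 T D f \<and> (\<forall>n\<le>M. f (t n) \<in> L2_space D) \<and>
      h \<in> H \<and>
      (\<forall>n\<in>{1..<M}. C_beta \<theta> t n * \<bar>\<rho>\<bar> * avg_step \<theta> t n \<le> (1 + \<theta>) / 4) \<and>
      dln_solution D r (\<T> h) \<mu> \<gamma> \<nu> lam \<rho> \<theta> M t f u w p \<longrightarrow>
      (\<forall>m. 1 < m \<and> m \<le> M \<longrightarrow>
        (1 + \<theta>) / 4 * (l2_norm D (u m))\<^sup>2
        + (\<Sum>n = 1..m - 1.
             (l2_norm D (a_comb \<theta> t u n))\<^sup>2
             + avg_step \<theta> t n *
                 (\<mu> / 2 * (l2_norm D (wgrad D (beta_comb \<theta> t u n)))\<^sup>2
                  + \<gamma> * (l2_norm D (beta_comb \<theta> t w n))\<^sup>2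
                  + lam * (l4_norm D (beta_comb \<theta> t u n)) ^ 4))
        \<le> exp (C\<theta> * T) *
            ((1 + \<theta>) / 4 * (l2_norm D (u 1))\<^sup>2 + (1 + \<theta>) / 4 * (l2_norm D (u 0))\<^sup>2
             + C / 2 / \<mu> * (\<Sum>n = 1..m - 1.
                 avg_step \<theta> t n * (l2_norm D (beta_comb \<theta> t (\<lambda>n. f (t n)) n))\<^sup>2)))"
    proof (rule exI[of _ C\<theta>], intro conjI allI impI; (elim conjE)?)
      show "C\<theta> > 0" using \<Lambda>(1) by (simp add: C\<theta>_def add_nonneg_pos)
      fix T :: real and M m :: nat and t f h u w p
      assume T: "T > 0" and grid: "time_grid T M t"
        and f: "\<forall>n\<le>M. f (t n) \<in> L2_space D"
        and step: "\<forall>n\<in>{1..<M}. C_beta \<theta> t n * \<bar>\<rho>\<bar> * avg_step \<theta> t n \<le> (1 + \<theta>) / 4"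
        and sol: "dln_solution D r (\<T> h) \<mu> \<gamma> \<nu> lam \<rho> \<theta> M t f u w p"
        and m: "1 < m" "m \<le> M"
      define k where "k n = avg_step \<theta> t n" for n
      define E where "E n = (1 + \<theta>) / 4 * (l2_norm D (u n))\<^sup>2 + (1 - \<theta>) / 4 * (l2_norm D (u (n - 1)))\<^sup>2" for n
      define S where "S n = (l2_norm D (a_comb \<theta> t u n))\<^sup>2
             + k n * (\<mu> / 2 * (l2_norm D (wgrad D (beta_comb \<theta> t u n)))\<^sup>2
                  + \<gamma> * (l2_norm D (beta_comb \<theta> t w n))\<^sup>2
                  + lam * (l4_norm D (beta_comb \<theta> t u n)) ^ 4)" for n
      define F where "F n = k n * (l2_norm D (beta_comb \<theta> t (\<lambda>n. f (t n)) n))\<^sup>2" for n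
      have kpos: "k n > 0" if "1 \<le> n" "n < M" for n
        unfolding k_def by (rule avg_step_pos[OF grid that \<theta>])
      have nonneg: "0 \<le> S n" "0 \<le> C / 2 / \<mu> * F n" "0 \<le> \<Lambda> * (\<bar>\<rho>\<bar> * k n)" if "1 \<le> n" "n < M" for n
        using kpos[OF that] \<mu> \<gamma> lam C \<Lambda> by (auto simp: S_def F_def l4_norm_def)
      have uL2: "u i \<in> L2_space D" if "i \<le> M" for i
        using sol that Xh_subset_H1 H1_imp_L2 by (fastforce simp: dln_solution_def)
      have one_step: "E (n + 1) + S n \<le> exp (\<Lambda> * (\<bar>\<rho>\<bar> * k n)) * (E n + C / 2 / \<mu> * F n)"
        if n: "1 \<le> n" "n < M" for n
      proof -
        have le: "n - 1 \<le> M" "n \<le> M" "n + 1 \<le> M" using n by auto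
        show ?thesis
          unfolding E_def add_diff_cancel_right'
        proof (rule growth[of "step_var t n" _ _ _ _ _ _ "(l2_norm D (beta_comb \<theta> t u n))\<^sup>2"])
          show "\<bar>step_var t n\<bar> < 1" by (rule abs_step_var_less_1[OF grid n])
          show "(\<Sum>l\<le>2. (dln_beta \<theta> (step_var t n) l)\<^sup>2) * (\<bar>\<rho>\<bar> * k n) \<le> (1 + \<theta>) / 4"
            using step n by (simp add: C_beta_def k_def mult.assoc)
          show "(l2_norm D (beta_comb \<theta> t u n))\<^sup>2
              \<le> (1 + \<kappa>) * (dln_beta \<theta> (step_var t n) 2)\<^sup>2 * (l2_norm D (u (n + 1)))\<^sup>2
                + (1 + 1 / \<kappa>) * (2 * (dln_beta \<theta> (step_var t n) 1)\<^sup>2 * (l2_norm D (u n))\<^sup>2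
                  + 2 * (dln_beta \<theta> (step_var t n) 0)\<^sup>2 * (l2_norm D (u (n - 1)))\<^sup>2)"
            if "0 < \<kappa>" for \<kappa>
            unfolding beta_comb_def by (intro l2_norm_three_point_le n that uL2 le)
          show "((1 + \<theta>) / 4 * (l2_norm D (u (n + 1)))\<^sup>2 + (1 - \<theta>) / 4 * (l2_norm D (u n))\<^sup>2) + S n
            \<le> ((1 + \<theta>) / 4 * (l2_norm D (u n))\<^sup>2 + (1 - \<theta>) / 4 * (l2_norm D (u (n - 1)))\<^sup>2)
              + \<bar>\<rho>\<bar> * k n * (l2_norm D (beta_comb \<theta> t u n))\<^sup>2 + C / 2 / \<mu> * F n"
            unfolding S_def F_def k_def
            by (rule dln_energy_inequality[OF sol grid n \<theta> _ \<mu> C poincare]) (use f in auto)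
        qed (use kpos[OF n] nonneg[OF n] in auto)
      qed
      have "E m + (\<Sum>n=1..<m. S n)
          \<le> exp (\<Sum>n=1..<m. \<Lambda> * (\<bar>\<rho>\<bar> * k n)) * (E 1 + (\<Sum>n=1..<m. C / 2 / \<mu> * F n))"
        using m by (intro discrete_gronwall one_step conjI nonneg) auto
      also have "\<dots> \<le> exp (C\<theta> * T) * ((1 + \<theta>) / 4 * (l2_norm D (u 1))\<^sup>2
          + (1 + \<theta>) / 4 * (l2_norm D (u 0))\<^sup>2 + C / 2 / \<mu> * (\<Sum>n=1..<m. F n))"
      proof (intro mult_mono)
        have "(\<Sum>n=1..<m. \<Lambda> * (\<bar>\<rho>\<bar> * k n)) = \<Lambda> * \<bar>\<rho>\<bar> * (\<Sum>n=1..<m. k n)"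
          by (simp add: sum_distrib_left mult.assoc)
        also have "\<dots> \<le> \<Lambda> * \<bar>\<rho>\<bar> * T"
          unfolding k_def using sum_avg_step_le[OF grid _ m(2) \<theta>] m \<Lambda> by (intro mult_left_mono) auto
        also have "\<dots> \<le> C\<theta> * T" using T by (simp add: C\<theta>_def algebra_simps)
        finally show "exp (\<Sum>n=1..<m. \<Lambda> * (\<bar>\<rho>\<bar> * k n)) \<le> exp (C\<theta> * T)" by simp
        have "(1 - \<theta>) / 4 * (l2_norm D (u 0))\<^sup>2 \<le> (1 + \<theta>) / 4 * (l2_norm D (u 0))\<^sup>2"
          using \<theta> by (intro mult_right_mono) auto
        then show "E 1 + (\<Sum>n=1..<m. C / 2 / \<mu> * F n)
            \<le> (1 + \<theta>) / 4 * (l2_norm D (u 1))\<^sup>2 + (1 + \<theta>) / 4 * (l2_norm D (u 0))\<^sup>2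
              + C / 2 / \<mu> * (\<Sum>n=1..<m. F n)"
          by (simp add: E_def sum_distrib_left)
        show "0 \<le> E 1 + (\<Sum>n=1..<m. C / 2 / \<mu> * F n)"
          using nonneg(2) m \<theta> by (auto simp: E_def intro!: add_nonneg_nonneg sum_nonneg)
      qed simp
      finally have bound: "E m + (\<Sum>n=1..<m. S n) \<le> exp (C\<theta> * T) * ((1 + \<theta>) / 4 * (l2_norm D (u 1))\<^sup>2
          + (1 + \<theta>) / 4 * (l2_norm D (u 0))\<^sup>2 + C / 2 / \<mu> * (\<Sum>n=1..<m. F n))" .
      have lower: "(1 + \<theta>) / 4 * (l2_norm D (u m))\<^sup>2 \<le> E m" using \<theta> by (simp add: E_def)
      have ivl: "{1..<m} = {1..m - 1}" using m by auto
      show "(1 + \<theta>) / 4 * (l2_norm D (u m))\<^sup>2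
        + (\<Sum>n = 1..m - 1.
             (l2_norm D (a_comb \<theta> t u n))\<^sup>2
             + avg_step \<theta> t n *
                 (\<mu> / 2 * (l2_norm D (wgrad D (beta_comb \<theta> t u n)))\<^sup>2
                  + \<gamma> * (l2_norm D (beta_comb \<theta> t w n))\<^sup>2
                  + lam * (l4_norm D (beta_comb \<theta> t u n)) ^ 4))
        \<le> exp (C\<theta> * T) *
            ((1 + \<theta>) / 4 * (l2_norm D (u 1))\<^sup>2 + (1 + \<theta>) / 4 * (l2_norm D (u 0))\<^sup>2
             + C / 2 / \<mu> * (\<Sum>n = 1..m - 1.
                 avg_step \<theta> t n * (l2_norm D (beta_comb \<theta> t (\<lambda>n. f (t n)) n))\<^sup>2))"
        by (rule order_trans[OF add_right_mono[OF lower] bound[unfolded ivl S_def F_def k_def]])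
    qed
  qed
qed

end
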